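(* There is a polynomial $p_3=p_3(n)$ of degree at most $2$ such that the following holds. Let $A\in\mathbb{R}^{n\times n}$ be symmetric positive definite, let $\widetilde Q\in\mathbb{R}^{n\times n}$ satisfy $\|\widetilde Q^T\widetilde Q-I\|_2\le p_1u<1$, let $\widetilde A=\widetilde Q^TA\widetilde Q$ be the (exact) preconditioned matrix, and let $\widetilde A_{\mathrm{comp}}$ be the computed preconditioned matrix obtained by forming $\widetilde Q^TA\widetilde Q$ in floating-point arithmetic at precision $u_h$ and demoting the result to precision $u$. Assume that (A1) $10n^{3/2}u(1-p_1u)^{-1}\kappa_2(A)<1$, (A2) $\gamma_h<\dfrac{u(1-p_1u)}{16n^{1/2}\kappa_2(A)}$, (A3) $14nu\,\kappa_2^S(\widetilde A)<1$. Then, for every $k=1,\dots,n$, the relative forward error $$\varepsilon_{fwd}^{(k)}=\frac{|\widehat\lambda_k(\widetilde A_{\mathrm{comp}})-\lambda_k(A)|}{\lambda_k(A)}$$ of the $k$th eigenvalue computed by applying the Jacobi algorithm at precision $u$ to $\widetilde A_{\mathrm{comp}}$ satisfies $$\varepsilon_{fwd}^{(k)}\le p_3\,\kappa_2^S(\widetilde A)\,u+p_1u,$$ provided that both terms on the right-hand side are less than $1$.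
   Context: Precisions: $u$ (working) and $u_h$ (high), $0<u_h<u$, are unit roundoffs of IEEE floating-point formats, with $nu_h<nu<1/2$ and $u<0.1$; $\gamma_h=nu_h/(1-nu_h)$. No underflow or overflow occurs. Arithmetic at precision $w$ obeys the standard model $\mathrm{fl}(x\ \mathrm{op}\ y)=(x\ \mathrm{op}\ y)(1+\delta)$, $|\delta|\le w$. Promoting a number from precision $u$ to precision $u_h$ is exact; demoting a number $x$ from precision $u_h$ to $u$ replaces it by $x(1+\delta)$ with $|\delta|\le u$. Mixed-precision preconditioned Jacobi algorithm. Input: symmetric $A$ and $\widetilde Q$ (both stored at precision $u$) with $\|\widetilde Q^T\widetilde Q-I\|_2\le p_1u<1$, where $p_1=p_1(n)$ is a low-degree polynomial in $n$. Step 1: compute $\widetilde Q^TA\widetilde Q$ entirely at precision $u_h$ by two conventional matrix-matrix multiplications (first $\widetilde Q^TA$, then the product with $\widetilde Q$), giving $\widetilde A_{\mathrm{h,comp}}$; demote it entrywise to precision $u$ to obtain $\widetilde A_{\mathrm{comp}}$, which is arranged to be symmetric. Step 2: apply to $\widetilde A_{\mathrm{comp}}$ the Jacobi eigenvalue algorithm (plane rotations annihilating off-diagonal entries) at precision $u$, stopping when the current iterate $(a_{ij})$ satisfies $|a_{ij}|\le \mathrm{tol}\sqrt{a_{ii}a_{jj}}$ for all $i\ne j$, with tol a multiple of $u$. Notation: $\lambda_k(B)$ is the $k$th largest eigenvalue of symmetric $B$, and $\widehat\lambda_k(B)$ the $k$th largest eigenvalue computed by the Jacobi algorithm of Step 2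 applied to $B$. The Jacobi algorithm is taken to have the accuracy established by Demmel and Veselić: there is a polynomial $p_J(n)$ of degree at most $2$ such that for every symmetric positive definite $B\in\mathbb{R}^{n\times n}$ with $p_Ju\,\kappa_2^S(B)<1$ one has $|\widehat\lambda_k(B)-\lambda_k(B)|\le p_J\,u\,\kappa_2^S(B)\,\lambda_k(B)$ for all $k$. For symmetric positive definite $B$: $\kappa_2(B)=\lambda_1(B)/\lambda_n(B)$, and the scaled condition number is $\kappa_2^S(B)=\kappa_2(DBD)$ with $D=\mathrm{diag}(b_{ii}^{-1/2})$. *)

theory Defs
  imports
    Complex_Main
    "Jordan_Normal_Form.Char_Poly"
begin

(* The dimension is quantified inside the statement (the polynomials in n are uniform in n),
   so matrices are those of Jordan_Normal_Form with explicit carriers. *)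

definition vec_norm2 :: "real vec \<Rightarrow> real" where
  "vec_norm2 x = sqrt (x \<bullet> x)"

definition mat_norm2 :: "real mat \<Rightarrow> real" where
  "mat_norm2 M = (SUP x \<in> {x \<in> carrier_vec (dim_col M). vec_norm2 x = 1}. vec_norm2 (M *\<^sub>v x))"

definition spd :: "nat \<Rightarrow> real mat \<Rightarrow> bool" where
  "spd n B \<longleftrightarrow> B \<in> carrier_mat n n \<and> transpose_mat B = B \<and>
     (\<forall>x \<in> carrier_vec n. x \<noteq> 0\<^sub>v n \<longrightarrow> x \<bullet> (B *\<^sub>v x) > 0)"

(* counted from k = 1 *)
definition kth_largest :: "nat \<Rightarrow> real list \<Rightarrow> real" where
  "kth_largest k xs = rev (sort xs) ! (k - 1)"

(* For symmetric B the real roots of the characteristic polynomial, with multiplicity,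
   are all n eigenvalues. *)
definition eigval :: "nat \<Rightarrow> real mat \<Rightarrow> real" where
  "eigval k B = kth_largest k (sorted_list_of_multiset (proots (char_poly B)))"

definition cond2 :: "real mat \<Rightarrow> real" where
  "cond2 B = eigval 1 B / eigval (dim_row B) B"

definition scaled_cond2 :: "real mat \<Rightarrow> real" where
  "scaled_cond2 B =
     (let D = mat_diag (dim_row B) (\<lambda>i. 1 / sqrt (B $$ (i, i))) in cond2 (D * B * D))"

(* The standard model: y is an admissible result of rounding the exact value x with unit
   roundoff w.  Also used for square roots and for demotion; promotion is the identity. *)
definition rounds_to :: "real \<Rightarrow> real \<Rightarrow> real \<Rightarrow> bool" where
  "rounds_to w x y \<longleftrightarrow> (\<exists>\<delta>. \<bar>\<delta>\<bar> \<le> w \<and> y = x * (1 + \<delta>))"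

(* Computed value of a sum of at least one term; the order of summation is arbitrary. *)
inductive fl_sum :: "real \<Rightarrow> real multiset \<Rightarrow> real \<Rightarrow> bool" for w where
  single: "fl_sum w {#x#} x"
| add: "fl_sum w X a \<Longrightarrow> fl_sum w Y b \<Longrightarrow> rounds_to w (a + b) c \<Longrightarrow> fl_sum w (X + Y) c"

definition fl_inner :: "real \<Rightarrow> real vec \<Rightarrow> real vec \<Rightarrow> real \<Rightarrow> bool" where
  "fl_inner w x y z \<longleftrightarrow>
     (\<exists>p. (\<forall>l < dim_vec x. rounds_to w (x $ l * y $ l) (p l)) \<and>
          fl_sum w (image_mset p (mset_set {..<dim_vec x})) z)"

definition fl_mat_mult :: "real \<Rightarrow> real mat \<Rightarrow> real mat \<Rightarrow> real mat \<Rightarrow> bool" where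
  "fl_mat_mult w X Y Z \<longleftrightarrow> Z \<in> carrier_mat (dim_row X) (dim_col Y) \<and>
     (\<forall>i < dim_row X. \<forall>j < dim_col Y. fl_inner w (row X i) (col Y j) (Z $$ (i, j)))"

(* The computed product is in general not symmetric.  Symmetry of the demoted matrix may be
   enforced by keeping only one of the entries (i,j), (j,i) of the computed product. *)
definition computed_precond :: "real \<Rightarrow> real \<Rightarrow> real mat \<Rightarrow> real mat \<Rightarrow> real mat \<Rightarrow> bool" where
  "computed_precond u uh A Q C \<longleftrightarrow>
     (\<exists>Y H. fl_mat_mult uh (transpose_mat Q) A Y \<and> fl_mat_mult uh Y Q H \<and>
        C \<in> carrier_mat (dim_row H) (dim_col H) \<and> transpose_mat C = C \<and>
        (\<forall>i < dim_row H. \<forall>j < dim_col H.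
           rounds_to u (H $$ (i, j)) (C $$ (i, j)) \<or> rounds_to u (H $$ (j, i)) (C $$ (i, j))))"

(* Computed tangent, cosine and sine of the rotation annihilating b in the symmetric 2x2 matrix
   with rows (a, b) and (b, d), by the formulas of Demmel and Veselic:
     z = (d - a) / (2 b),  t = sign z / (|z| + sqrt (1 + z^2)),
     c = 1 / sqrt (1 + t^2),  s = c t,   where sign 0 = 1. *)
definition fl_rotation ::
    "real \<Rightarrow> real \<Rightarrow> real \<Rightarrow> real \<Rightarrow> real \<Rightarrow> real \<Rightarrow> real \<Rightarrow> bool" where
  "fl_rotation u a b d t c s \<longleftrightarrow>
     (\<exists>e f z z2 v r g t2 v' r'.
        rounds_to u (d - a) e \<and> rounds_to u (2 * b) f \<and> rounds_to u (e / f) z \<and>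
        rounds_to u (z * z) z2 \<and> rounds_to u (1 + z2) v \<and> rounds_to u (sqrt v) r \<and>
        rounds_to u (\<bar>z\<bar> + r) g \<and> rounds_to u ((if z < 0 then - 1 else 1) / g) t \<and>
        rounds_to u (t * t) t2 \<and> rounds_to u (1 + t2) v' \<and> rounds_to u (sqrt v') r' \<and>
        rounds_to u (1 / r') c \<and> rounds_to u (c * t) s)"

(* One computed rotation in the plane (p,q).  The pivot entries are set to zero and the
   pivot diagonal entries are updated by -/+ t h_pq, as in Demmel and Veselic. *)
definition jacobi_step :: "real \<Rightarrow> nat \<Rightarrow> nat \<Rightarrow> real mat \<Rightarrow> real mat \<Rightarrow> bool" where
  "jacobi_step u p q H H' \<longleftrightarrow>
     H' \<in> carrier_mat (dim_row H) (dim_row H) \<and> transpose_mat H' = H' \<and>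
     H' $$ (p, q) = 0 \<and>
     (\<exists>t c s. fl_rotation u (H $$ (p, p)) (H $$ (p, q)) (H $$ (q, q)) t c s \<and>
        (\<exists>x. rounds_to u (t * H $$ (p, q)) x \<and>
             rounds_to u (H $$ (p, p) - x) (H' $$ (p, p)) \<and>
             rounds_to u (H $$ (q, q) + x) (H' $$ (q, q))) \<and>
        (\<forall>i < dim_row H. i \<noteq> p \<and> i \<noteq> q \<longrightarrow>
           (\<exists>x y. rounds_to u (c * H $$ (i, p)) x \<and> rounds_to u (s * H $$ (i, q)) y \<and>
                  rounds_to u (x - y) (H' $$ (i, p))) \<and>
           (\<exists>x y. rounds_to u (s * H $$ (i, p)) x \<and> rounds_to u (c * H $$ (i, q)) y \<and>
                  rounds_to u (x + y) (H' $$ (i, q))))) \<and>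
     (\<forall>i < dim_row H. \<forall>j < dim_row H. i \<notin> {p, q} \<and> j \<notin> {p, q} \<longrightarrow> H' $$ (i, j) = H $$ (i, j))"

definition jacobi_converged :: "real \<Rightarrow> real mat \<Rightarrow> bool" where
  "jacobi_converged tol H \<longleftrightarrow>
     (\<forall>i < dim_row H. \<forall>j < dim_row H. i \<noteq> j \<longrightarrow>
        \<bar>H $$ (i, j)\<bar> \<le> tol * sqrt (H $$ (i, i) * H $$ (j, j)))"

(* jacobi_run u tol H ds: some terminating execution started at the iterate H returns the
   (unordered) list ds of computed eigenvalues.  The pivoting strategy is arbitrary. *)
inductive jacobi_run :: "real \<Rightarrow> real \<Rightarrow> real mat \<Rightarrow> real list \<Rightarrow> bool" for u tol where
  stop: "jacobi_converged tol H \<Longrightarrow> jacobi_run u tol H (diag_mat H)"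
| rotate: "\<not> jacobi_converged tol H \<Longrightarrow> p < q \<Longrightarrow> q < dim_row H \<Longrightarrow> H $$ (p, q) \<noteq> 0 \<Longrightarrow>
     jacobi_step u p q H H' \<Longrightarrow> jacobi_run u tol H' ds \<Longrightarrow> jacobi_run u tol H ds"

(* jac is an implementation of the Jacobi algorithm (a map from matrices to lists of computed
   eigenvalues) with the Demmel-Veselic accuracy, p_J being the polynomial in that bound.
   Nothing is required of jac outside the range of validity of the bound.  Accuracy is not
   postulated for all executions: the model admits executions with arbitrarily many rotations,
   for which no such uniform bound can be expected. *)
definition accurate_jacobi :: "real poly \<Rightarrow> real \<Rightarrow> real \<Rightarrow> (real mat \<Rightarrow> real list) \<Rightarrow> bool" where
  "accurate_jacobi pJ u tol jac \<longleftrightarrow>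
     (\<forall>n B. spd n B \<and> poly pJ (real n) * u * scaled_cond2 B < 1 \<longrightarrow>
        jacobi_run u tol B (jac B) \<and>
        (\<forall>k \<in> {1..n}. \<bar>kth_largest k (jac B) - eigval k B\<bar>
            \<le> poly pJ (real n) * u * scaled_cond2 B * eigval k B))"

end

theory Submission imports Defs "HOL-Analysis.L2_Norm"
begin

text \<open>Write \<open>T = Q\<^sup>T A Q\<close> for the exact and \<open>C\<close> for the computed preconditioned matrix, \<open>h\<close> for the bound on
the norm of \<open>Q\<^sup>T Q - I\<close>, and \<open>K\<close> for the scaled condition number of \<open>T\<close>. The forward error has three sources.

\<^item> Preconditioning. \<open>T\<close> and \<open>A\<close> have the same quadratic form up to the substitution \<open>x \<mapsto> Q x\<close>, which
  changes \<open>\<parallel>x\<parallel>\<^sup>2\<close> by a factor between \<open>1 - h\<close> and \<open>1 + h\<close>; hence the eigenvalues move by a relative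
  amount of at most \<open>h\<close> (\<open>ostrowski\<close>).

\<^item> Rounding. The two products at the high precision have an error that is small relative to the norm of
  \<open>A\<close>. Since every diagonal entry of \<open>T\<close> is at least \<open>(1 - h) \<lambda>\<^sub>n(A)\<close>, the assumption on \<open>\<gamma>\<^sub>h\<close>, in which
  \<open>\<kappa>\<^sub>2(A)\<close> appears, turns this error into one of size \<open>u\<close> relative to \<open>\<surd>(T\<^sub>i\<^sub>i T\<^sub>j\<^sub>j)\<close>, which is also the size of
  the demotion error (\<open>computed_precond_entry_error\<close>). Such an entrywise error changes the quadratic
  form of \<open>T\<close> by a relative amount of at most \<open>t = (7/5) n u K\<close> (\<open>scaled_entrywise_perturbation\<close>): after
  scaling to unit diagonal the perturbation has norm at most \<open>(7/5) n u\<close>, and the smallest eigenvalue of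
  the scaled matrix is at least \<open>1 / K\<close>. So the eigenvalues move by a relative amount of at most \<open>t\<close>.

\<^item> The Jacobi algorithm. Its accuracy is governed by the scaled condition number of \<open>C\<close>, which exceeds
  \<open>K\<close> by a factor of at most \<open>((1 + t) / (1 - t))\<^sup>2\<close> (\<open>scaled_cond2_perturbation\<close>). The assumption
  \<open>14 n u K < 1\<close> means \<open>t < 1/10\<close>, so that this factor is less than \<open>3/2\<close>.

All statements about individual eigenvalues rest on one min-max argument (\<open>eigval_comparison\<close>): an
inequality between the Rayleigh quotients of two symmetric matrices, possibly along a linear
substitution, is inherited by the \<open>k\<close>th largest eigenvalues. It needs an orthonormal basis of
eigenvectors that is ordered like the roots of the characteristic polynomial; this is
\<open>sorted_spectral_decomposition\<close>.

The polynomial of the conclusion is \<open>p\<^sub>3(n) = 4 P(n) + 3 n\<close>, where \<open>P\<close> has the absolute values of the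
coefficients of \<open>p\<^sub>J\<close>. The linear term pays for the rounding error and the other one for the Jacobi algorithm.\<close>


section \<open>Rounding errors\<close>

text \<open>However the summation is bracketed, a term passes through at most \<open>size X - 1\<close> additions, each of
which multiplies it by a factor \<open>1 + \<delta>\<close>. In the induction step the last addition contributes one
factor more to both partial sums; the other partial sum has at least one term, so that the exponent
grows by at least one.\<close>

lemma fl_sum_error:
  assumes "fl_sum w X s" and "0 \<le> w"
  shows "X \<noteq> {#} \<and>
    \<bar>s - sum_mset X\<bar> \<le> ((1 + w) ^ (size X - 1) - 1) * sum_mset (image_mset abs X)"
  using assms(1)
proof induction
  case (single x)
  then show ?case by simp
next
  case (add X a Y b c)
  define g where "g m = (1 + w) ^ (m - 1)" for m :: nat
  define SX where "SX = sum_mset (image_mset abs X)"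
  define SY where "SY = sum_mset (image_mset abs Y)"
  have abs_sum: "\<bar>sum_mset Z\<bar> \<le> sum_mset (image_mset abs Z)" for Z :: "real multiset"
    by (induction Z) auto
  have pos: "0 \<le> SX" "0 \<le> SY" unfolding SX_def SY_def using abs_sum abs_ge_zero order_trans by blast+
  have X: "\<bar>a - sum_mset X\<bar> \<le> (g (size X) - 1) * SX"
    and Y: "\<bar>b - sum_mset Y\<bar> \<le> (g (size Y) - 1) * SY"
    using add.IH by (simp_all add: g_def SX_def SY_def)
  obtain d where d: "\<bar>d\<bar> \<le> w" "c = (a + b) * (1 + d)"
    using add.hyps(3) unfolding rounds_to_def by blast
  have "\<bar>a\<bar> \<le> g (size X) * SX" "\<bar>b\<bar> \<le> g (size Y) * SY"
    using X Y abs_sum[of X] abs_sum[of Y] unfolding SX_def[symmetric] SY_def[symmetric]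
    by (auto simp: algebra_simps)
  hence "\<bar>a + b\<bar> \<le> g (size X) * SX + g (size Y) * SY" by linarith
  hence "\<bar>(a + b) * d\<bar> \<le> (g (size X) * SX + g (size Y) * SY) * w"
    unfolding abs_mult using d(1) by (intro mult_mono) auto
  moreover have "c - (sum_mset X + sum_mset Y)
      = (a - sum_mset X) + (b - sum_mset Y) + (a + b) * d"
    using d(2) by (simp add: algebra_simps)
  ultimately have "\<bar>c - (sum_mset X + sum_mset Y)\<bar>
      \<le> (g (size X) * (1 + w) - 1) * SX + (g (size Y) * (1 + w) - 1) * SY"
    using X Y by (simp add: algebra_simps)
  moreover have "g (size X) * (1 + w) \<le> g (size X + size Y)"
    "g (size Y) * (1 + w) \<le> g (size X + size Y)"
  proof -
    have 1: "size X \<noteq> 0" "size Y \<noteq> 0" using add.IH by auto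
    have "g (size X) * (1 + w) = (1 + w) ^ size X" "g (size Y) * (1 + w) = (1 + w) ^ size Y"
      unfolding g_def using 1 by (metis Suc_diff_1 gr0I mult.commute power_Suc)+
    moreover have "size X \<le> size X + size Y - 1" "size Y \<le> size X + size Y - 1"
      using 1 by linarith+
    hence "(1 + w) ^ size X \<le> g (size X + size Y)" "(1 + w) ^ size Y \<le> g (size X + size Y)"
      unfolding g_def using assms(2) by (intro power_increasing; simp)+
    ultimately show "g (size X) * (1 + w) \<le> g (size X + size Y)"
      "g (size Y) * (1 + w) \<le> g (size X + size Y)" by simp_all
  qed
  ultimately have "\<bar>c - (sum_mset X + sum_mset Y)\<bar>
      \<le> (g (size X + size Y) - 1) * SX + (g (size X + size Y) - 1) * SY"
    using pos by (smt (verit, best) mult_right_mono)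
  then show ?case using add.IH by (simp add: g_def SX_def SY_def algebra_simps)
qed

text \<open>The rounding of the products adds one more factor \<open>1 + \<delta>\<close> to the \<open>dim_vec x - 1\<close> of the summation.\<close>

lemma fl_inner_error:
  assumes "fl_inner w x y z" and "0 \<le> w"
  shows "\<bar>z - (\<Sum>l<dim_vec x. x $ l * y $ l)\<bar>
    \<le> ((1 + w) ^ dim_vec x - 1) * (\<Sum>l<dim_vec x. \<bar>x $ l * y $ l\<bar>)"
proof -
  let ?n = "dim_vec x"
  let ?S = "\<Sum>l<?n. \<bar>x $ l * y $ l\<bar>"
  obtain p where p: "\<And>l. l < ?n \<Longrightarrow> rounds_to w (x $ l * y $ l) (p l)"
    and s: "fl_sum w (image_mset p (mset_set {..<?n})) z"
    using assms(1) unfolding fl_inner_def by blast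
  have p1: "\<bar>p l - x $ l * y $ l\<bar> \<le> w * \<bar>x $ l * y $ l\<bar>" if l: "l < ?n" for l
  proof -
    obtain d where d: "\<bar>d\<bar> \<le> w" "p l = x $ l * y $ l * (1 + d)"
      using p[OF l] unfolding rounds_to_def by blast
    have "p l - x $ l * y $ l = x $ l * y $ l * d" by (simp add: d(2) algebra_simps)
    thus ?thesis using d(1) by (simp add: abs_mult mult.commute mult_right_mono)
  qed
  have "?n \<noteq> 0" and e: "\<bar>z - (\<Sum>l<?n. p l)\<bar> \<le> ((1 + w) ^ (?n - 1) - 1) * (\<Sum>l<?n. \<bar>p l\<bar>)"
    using fl_sum_error[OF s assms(2)] by (auto simp: sum_unfold_sum_mset image_mset.compositionality comp_def)
  hence n: "(1 + w) ^ (?n - 1) * (1 + w) = (1 + w) ^ ?n"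
    by (metis Suc_diff_1 gr0I mult.commute power_Suc)
  have "(\<Sum>l<?n. \<bar>p l\<bar>) \<le> (\<Sum>l<?n. (1 + w) * \<bar>x $ l * y $ l\<bar>)"
    using p1 by (intro sum_mono) (fastforce simp: algebra_simps)
  hence "\<bar>z - (\<Sum>l<?n. p l)\<bar> \<le> ((1 + w) ^ (?n - 1) - 1) * ((1 + w) * ?S)"
    using assms(2) by (intro order_trans[OF e] mult_left_mono) (auto simp: sum_distrib_left)
  moreover have "\<bar>(\<Sum>l<?n. p l) - (\<Sum>l<?n. x $ l * y $ l)\<bar> \<le> w * ?S"
    unfolding sum_subtractf[symmetric] sum_distrib_left
    using p1 by (intro order_trans[OF sum_abs] sum_mono) auto
  ultimately have "\<bar>z - (\<Sum>l<?n. x $ l * y $ l)\<bar>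
      \<le> ((1 + w) ^ (?n - 1) * (1 + w) - 1) * ?S"
    by (simp add: algebra_simps)
  thus ?thesis unfolding n .
qed

lemma power_minus_one_le_gamma:
  fixes w :: real
  assumes "0 \<le> w" and "real n * w < 1"
  shows "(1 + w) ^ n - 1 \<le> real n * w / (1 - real n * w)"
proof -
  have "(1 + w) ^ n * (1 - real n * w) \<le> 1" using assms(2)
  proof (induction n)
    case (Suc n)
    have "real n * w < 1" using Suc.prems assms(1) by (simp add: algebra_simps)
    have "(1 + w) * (1 - real (Suc n) * w) \<le> 1 - real n * w"
      using assms(1) by (simp add: algebra_simps)
    hence "(1 + w) ^ n * ((1 + w) * (1 - real (Suc n) * w)) \<le> (1 + w) ^ n * (1 - real n * w)"
      using assms(1) by (intro mult_left_mono) auto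
    thus ?case using Suc.IH[OF \<open>real n * w < 1\<close>] by (simp add: algebra_simps)
  qed simp
  thus ?thesis using assms(2) by (simp add: field_simps)
qed

text \<open>The error of the first product is carried along by the second one, and the second one adds its own
error, relative to the absolute values of the first computed product; these exceed
\<open>\<bar>Q\<^sup>T\<bar> \<bar>A\<bar>\<close> by a factor of at most \<open>1 + g\<close>. Together this gives \<open>g + g (1 + g) = 2 g + g\<^sup>2\<close>.\<close>

lemma fl_congruence_error:
  assumes A: "A \<in> carrier_mat n n" and Q: "Q \<in> carrier_mat n n"
    and Y: "fl_mat_mult w (transpose_mat Q) A Y" and H: "fl_mat_mult w Y Q H"
    and w: "0 \<le> w" "real n * w < 1" and g: "g = real n * w / (1 - real n * w)"
    and ij: "i < n" "j < n"
  shows "\<bar>H $$ (i, j) - (transpose_mat Q * A * Q) $$ (i, j)\<bar>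
    \<le> (2 * g + g\<^sup>2) * (\<Sum>l<n. \<Sum>k<n. \<bar>A $$ (k, l)\<bar> * \<bar>Q $$ (k, i) * Q $$ (l, j)\<bar>)"
proof -
  have Yc: "Y \<in> carrier_mat n n" using Y A Q unfolding fl_mat_mult_def by auto
  have "0 \<le> g" unfolding g using w by simp
  have gamma: "(1 + w) ^ n - 1 \<le> g" unfolding g by (rule power_minus_one_le_gamma[OF w])
  define T where "T l = (\<Sum>k<n. Q $$ (k, i) * A $$ (k, l))" for l
  define R where "R l = (\<Sum>k<n. \<bar>Q $$ (k, i) * A $$ (k, l)\<bar>)" for l
  have R0: "0 \<le> R l" for l unfolding R_def by (simp add: sum_nonneg)
  have TR: "\<bar>T l\<bar> \<le> R l" for l unfolding T_def R_def by (rule sum_abs)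
  have YT: "\<bar>Y $$ (i, l) - T l\<bar> \<le> g * R l" if l: "l < n" for l
  proof -
    have "fl_inner w (row (transpose_mat Q) i) (col A l) (Y $$ (i, l))"
      using Y A Q ij l unfolding fl_mat_mult_def by auto
    from fl_inner_error[OF this w(1)]
    have "\<bar>Y $$ (i, l) - T l\<bar> \<le> ((1 + w) ^ n - 1) * R l"
      using A Q ij l unfolding T_def R_def by simp
    also have "\<dots> \<le> g * R l" by (rule mult_right_mono[OF gamma R0])
    finally show ?thesis .
  qed
  have Ybd: "\<bar>Y $$ (i, l)\<bar> \<le> (1 + g) * R l" if "l < n" for l
    using YT[OF that] TR[of l] by (simp add: algebra_simps)
  define G where "G = (\<Sum>l<n. R l * \<bar>Q $$ (l, j)\<bar>)"
  have "fl_inner w (row Y i) (col Q j) (H $$ (i, j))"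
    using H Yc Q ij unfolding fl_mat_mult_def by auto
  from fl_inner_error[OF this w(1)]
  have "\<bar>H $$ (i, j) - (\<Sum>l<n. Y $$ (i, l) * Q $$ (l, j))\<bar>
      \<le> ((1 + w) ^ n - 1) * (\<Sum>l<n. \<bar>Y $$ (i, l) * Q $$ (l, j)\<bar>)"
    using Yc Q ij by simp
  also have "\<dots> \<le> g * (\<Sum>l<n. \<bar>Y $$ (i, l) * Q $$ (l, j)\<bar>)"
    by (rule mult_right_mono[OF gamma]) (simp add: sum_nonneg)
  also have "\<dots> \<le> g * (\<Sum>l<n. (1 + g) * (R l * \<bar>Q $$ (l, j)\<bar>))"
    using Ybd \<open>0 \<le> g\<close> by (intro mult_left_mono sum_mono)
      (auto simp: abs_mult mult.assoc[symmetric] intro!: mult_right_mono)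
  finally have 1: "\<bar>H $$ (i, j) - (\<Sum>l<n. Y $$ (i, l) * Q $$ (l, j))\<bar> \<le> g * (1 + g) * G"
    unfolding G_def by (simp add: sum_distrib_left[symmetric] mult.assoc)
  have "\<bar>(\<Sum>l<n. Y $$ (i, l) * Q $$ (l, j)) - (\<Sum>l<n. T l * Q $$ (l, j))\<bar>
      \<le> (\<Sum>l<n. \<bar>(Y $$ (i, l) - T l) * Q $$ (l, j)\<bar>)"
    unfolding sum_subtractf[symmetric] left_diff_distrib[symmetric] by (rule sum_abs)
  also have "\<dots> \<le> (\<Sum>l<n. g * (R l * \<bar>Q $$ (l, j)\<bar>))"
    using YT by (intro sum_mono) (auto simp: abs_mult mult.assoc[symmetric] intro!: mult_right_mono)
  finally have 2: "\<bar>(\<Sum>l<n. Y $$ (i, l) * Q $$ (l, j)) - (\<Sum>l<n. T l * Q $$ (l, j))\<bar> \<le> g * G"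
    unfolding G_def by (simp add: sum_distrib_left)
  have 3: "(transpose_mat Q * A * Q) $$ (i, j) = (\<Sum>l<n. T l * Q $$ (l, j))"
    using A Q ij unfolding T_def
    by (simp del: assoc_mult_mat add: scalar_prod_def lessThan_atLeast0)
  have "G = (\<Sum>l<n. \<Sum>k<n. \<bar>A $$ (k, l)\<bar> * \<bar>Q $$ (k, i) * Q $$ (l, j)\<bar>)"
    unfolding G_def R_def sum_distrib_right by (simp add: abs_mult mult_ac)
  moreover have "\<bar>H $$ (i, j) - (\<Sum>l<n. T l * Q $$ (l, j))\<bar> \<le> (2 * g + g\<^sup>2) * G"
    using 1 2 by (simp add: algebra_simps power2_eq_square)
  ultimately show ?thesis unfolding 3 by simp
qed

section \<open>Quadratic forms\<close>

abbreviation quad :: "real mat \<Rightarrow> real vec \<Rightarrow> real" where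
  "quad B x \<equiv> x \<bullet> (B *\<^sub>v x)"

lemma scalar_prod_sum:
  "y \<in> carrier_vec n \<Longrightarrow> x \<bullet> y = (\<Sum>i<n. x $ i * y $ i)"
  by (auto simp: scalar_prod_def lessThan_atLeast0)

lemma scalar_prod_self_sum:
  "a \<in> carrier_vec n \<Longrightarrow> a \<bullet> a = (\<Sum>i<n. (a $ i :: real)\<^sup>2)"
  by (simp add: scalar_prod_sum power2_eq_square)

lemma quad_sum:
  assumes "B \<in> carrier_mat n n" "x \<in> carrier_vec n"
  shows "quad B x = (\<Sum>i<n. \<Sum>j<n. x $ i * B $$ (i, j) * x $ j)"
proof -
  have "(B *\<^sub>v x) $ i = (\<Sum>j<n. B $$ (i, j) * x $ j)" if "i < n" for i
    using assms that by (simp add: scalar_prod_sum[of _ n])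
  thus ?thesis using assms
    by (subst scalar_prod_sum[of _ n]) (auto simp: sum_distrib_left mult.assoc)
qed

lemma real_scalar_prod_self_pos:
  fixes x :: "real vec"
  assumes "x \<in> carrier_vec n" "x \<noteq> 0\<^sub>v n"
  shows "0 < x \<bullet> x"
proof -
  obtain i where i: "i < n" "x $ i \<noteq> 0" using assms by (metis carrier_vecD eq_vecI index_zero_vec)
  have "0 < (x $ i)\<^sup>2" using i by simp
  also have "\<dots> \<le> (\<Sum>i<n. (x $ i)\<^sup>2)"
    by (rule member_le_sum) (use i in auto)
  finally show ?thesis by (simp add: scalar_prod_sum[OF assms(1)] power2_eq_square)
qed

lemma real_scalar_prod_self_nonneg: "0 \<le> (x :: real vec) \<bullet> x"
  by (auto simp: scalar_prod_def intro: sum_nonneg)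

lemma mult3_mat_vec:
  assumes "X \<in> carrier_mat n n" "Y \<in> carrier_mat n n" "Z \<in> carrier_mat n n" "x \<in> carrier_vec n"
  shows "(X * Y * Z) *\<^sub>v x = X *\<^sub>v (Y *\<^sub>v (Z *\<^sub>v x))"
proof -
  have "(X * Y * Z) *\<^sub>v x = (X * Y) *\<^sub>v (Z *\<^sub>v x)"
    by (rule assoc_mult_mat_vec[OF mult_carrier_mat[OF assms(1,2)] assms(3,4)])
  also have "\<dots> = X *\<^sub>v (Y *\<^sub>v (Z *\<^sub>v x))"
    by (rule assoc_mult_mat_vec[OF assms(1,2) mult_mat_vec_carrier[OF assms(3,4)]])
  finally show ?thesis .
qed

lemma quad_congruence:
  assumes "B \<in> carrier_mat n n" "S \<in> carrier_mat n n" "x \<in> carrier_vec n"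
  shows "quad (transpose_mat S * B * S) x = quad B (S *\<^sub>v x)"
proof -
  have "quad (transpose_mat S * B * S) x = (transpose_mat S *\<^sub>v (B *\<^sub>v (S *\<^sub>v x))) \<bullet> x"
    using assms mult3_mat_vec[of "transpose_mat S" n B S x]
    by (simp del: assoc_mult_mat add: comm_scalar_prod[of x n] mult_mat_vec_carrier[of _ n n])
  also have "\<dots> = (B *\<^sub>v (S *\<^sub>v x)) \<bullet> (S *\<^sub>v x)"
    using assms by (intro transpose_vec_mult_scalar[of _ n n]) auto
  also have "\<dots> = quad B (S *\<^sub>v x)"
    using assms by (intro comm_scalar_prod[of _ n]) auto
  finally show ?thesis .
qed

lemma congruence_index:
  assumes "B \<in> carrier_mat n n" "S \<in> carrier_mat n n" "i < n" "j < n"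
  shows "(transpose_mat S * B * S) $$ (i, j) = col S i \<bullet> (B *\<^sub>v col S j)"
proof -
  have "transpose_mat S * B * S = transpose_mat S * (B * S)"
    using assms by (intro assoc_mult_mat) auto
  also have "\<dots> $$ (i, j) = row (transpose_mat S) i \<bullet> col (B * S) j"
    using assms by auto
  also have "\<dots> = col S i \<bullet> (B *\<^sub>v col S j)"
    using assms(2,3) unfolding col_mult2[OF assms(1,2,4)] by simp
  finally show ?thesis .
qed

lemma congruence_symmetric:
  fixes B :: "real mat"
  assumes "B \<in> carrier_mat n n" "S \<in> carrier_mat n n" "transpose_mat B = B"
  shows "transpose_mat (transpose_mat S * B * S) = transpose_mat S * B * S"
  using assms
  by (simp add: transpose_mult[of _ n n _ n] assoc_mult_mat[of _ n n _ n _ n])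

lemma diag_mult_vec:
  fixes d :: "nat \<Rightarrow> real"
  assumes "x \<in> carrier_vec n"
  shows "mat_diag n d *\<^sub>v x = vec n (\<lambda>i. d i * x $ i)"
proof (rule eq_vecI)
  fix i assume "i < dim_vec (vec n (\<lambda>i. d i * x $ i))"
  hence i: "i < n" by simp
  have "(mat_diag n d *\<^sub>v x) $ i = (\<Sum>j<n. (if i = j then d j else 0) * x $ j)"
    using i assms unfolding mat_diag_def by (simp add: scalar_prod_sum[of _ n])
  also have "\<dots> = (\<Sum>j<n. if i = j then d j * x $ j else 0)" by (rule sum.cong) auto
  finally show "(mat_diag n d *\<^sub>v x) $ i = vec n (\<lambda>i. d i * x $ i) $ i" using i by simp
qed (simp add: mat_diag_def)

lemma quad_diag:
  assumes "x \<in> carrier_vec n"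
  shows "quad (mat_diag n d) x = (\<Sum>i<n. d i * (x $ i)\<^sup>2)"
  unfolding diag_mult_vec[OF assms]
  by (subst scalar_prod_sum[of _ n]) (auto simp: power2_eq_square mult_ac)

lemma orthogonal_scalar_prod:
  fixes P :: "real mat"
  assumes "P \<in> carrier_mat n n" "transpose_mat P * P = 1\<^sub>m n" "x \<in> carrier_vec n"
  shows "(P *\<^sub>v x) \<bullet> (P *\<^sub>v x) = x \<bullet> x"
  using quad_congruence[of "1\<^sub>m n" n P x] assms by simp

lemma orthogonal_transpose:
  fixes P :: "real mat"
  assumes "P \<in> carrier_mat n n" "transpose_mat P * P = 1\<^sub>m n"
  shows "P * transpose_mat P = 1\<^sub>m n"
  using mat_mult_left_right_inverse[of "transpose_mat P" n P] assms by simp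

section \<open>Spectral decomposition\<close>

text \<open>Take a complex eigenvector \<open>x + \<i> y\<close> for a complex root \<open>z\<close> of the characteristic polynomial. Comparing
\<open>y \<bullet> B x\<close> with \<open>x \<bullet> B y\<close> gives \<open>Im z (\<parallel>x\<parallel>\<^sup>2 + \<parallel>y\<parallel>\<^sup>2) = 0\<close>, so that \<open>z\<close> is real and a nonzero one of \<open>x\<close> and
\<open>y\<close> is a real eigenvector.\<close>

lemma symmetric_real_eigenvector:
  fixes B :: "real mat"
  assumes B: "B \<in> carrier_mat n n" and sym: "transpose_mat B = B" and n: "0 < n"
  shows "\<exists>c v. v \<in> carrier_vec n \<and> v \<bullet> v = 1 \<and> B *\<^sub>v v = c \<cdot>\<^sub>v v"
proof -
  define BC where "BC = map_mat complex_of_real B"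
  have BC: "BC \<in> carrier_mat n n" using B by (simp add: BC_def)
  obtain as where as: "char_poly BC = (\<Prod>a\<leftarrow>as. [:- a, 1:])" "length as = n"
    using char_poly_factorized[OF BC] by blast
  obtain z where "z \<in> set as" using as(2) n by (cases as) auto
  hence "poly (char_poly BC) z = 0" unfolding as(1) poly_prod_list by (force simp: prod_list_zero_iff)
  hence "eigenvalue BC z" using eigenvalue_root_char_poly[OF BC] by blast
  then obtain w where w: "w \<in> carrier_vec n" "w \<noteq> 0\<^sub>v n" "BC *\<^sub>v w = z \<cdot>\<^sub>v w"
    using BC unfolding eigenvalue_def eigenvector_def by auto
  define x where "x = map_vec Re w"
  define y where "y = map_vec Im w"
  have xy: "x \<in> carrier_vec n" "y \<in> carrier_vec n" using w(1) by (auto simp: x_def y_def)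
  have ev: "(\<Sum>j<n. complex_of_real (B $$ (i, j)) * w $ j) = z * w $ i" if i: "i < n" for i
  proof -
    have "(BC *\<^sub>v w) $ i = (\<Sum>j<n. complex_of_real (B $$ (i, j)) * w $ j)"
      using i B w(1) by (simp add: BC_def scalar_prod_sum[of _ n])
    thus ?thesis using w i by simp
  qed
  have Bx: "B *\<^sub>v x = Re z \<cdot>\<^sub>v x - Im z \<cdot>\<^sub>v y"
  proof (rule eq_vecI)
    fix i assume "i < dim_vec (Re z \<cdot>\<^sub>v x - Im z \<cdot>\<^sub>v y)"
    hence i: "i < n" using xy by simp
    have "(B *\<^sub>v x) $ i = (\<Sum>j<n. B $$ (i, j) * x $ j)"
      using i B xy by (simp add: scalar_prod_sum[of _ n])
    also have "\<dots> = Re (\<Sum>j<n. complex_of_real (B $$ (i, j)) * w $ j)"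
      using w(1) by (simp add: x_def)
    finally show "(B *\<^sub>v x) $ i = (Re z \<cdot>\<^sub>v x - Im z \<cdot>\<^sub>v y) $ i"
      using ev[OF i] i w(1) by (simp add: x_def y_def)
  qed (use B xy in auto)
  have By: "B *\<^sub>v y = Im z \<cdot>\<^sub>v x + Re z \<cdot>\<^sub>v y"
  proof (rule eq_vecI)
    fix i assume "i < dim_vec (Im z \<cdot>\<^sub>v x + Re z \<cdot>\<^sub>v y)"
    hence i: "i < n" using xy by simp
    have "(B *\<^sub>v y) $ i = (\<Sum>j<n. B $$ (i, j) * y $ j)"
      using i B xy by (simp add: scalar_prod_sum[of _ n])
    also have "\<dots> = Im (\<Sum>j<n. complex_of_real (B $$ (i, j)) * w $ j)"
      using w(1) by (simp add: y_def)
    finally show "(B *\<^sub>v y) $ i = (Im z \<cdot>\<^sub>v x + Re z \<cdot>\<^sub>v y) $ i"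
      using ev[OF i] i w(1) by (simp add: x_def y_def)
  qed (use B xy in auto)
  have "(B *\<^sub>v y) \<bullet> x = y \<bullet> (B *\<^sub>v x)"
    using transpose_vec_mult_scalar[OF B xy(1) xy(2)] sym by simp
  hence "Im z * (x \<bullet> x) + Im z * (y \<bullet> y) = 0"
    unfolding Bx By using xy comm_scalar_prod[OF xy]
    by (simp add: add_scalar_prod_distrib[of _ n] scalar_prod_minus_distrib[of _ n])
  hence im: "Im z * (x \<bullet> x + y \<bullet> y) = 0" by (simp add: algebra_simps)
  have "x \<noteq> 0\<^sub>v n \<or> y \<noteq> 0\<^sub>v n"
  proof (rule ccontr)
    assume 0: "\<not> ?thesis"
    have "w $ i = 0" if "i < n" for i
      using 0 that w(1) unfolding x_def y_def
      by (metis carrier_vecD complex_eqI index_map_vec(1) index_zero_vec(1) zero_complex.simps)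
    hence "w = 0\<^sub>v n" using w(1) by (intro eq_vecI) auto
    thus False using w(2) by simp
  qed
  hence "Im z = 0"
    using im real_scalar_prod_self_pos[OF xy(1)] real_scalar_prod_self_pos[OF xy(2)]
      real_scalar_prod_self_nonneg[of x] real_scalar_prod_self_nonneg[of y]
    by (metis add_nonneg_pos add_pos_nonneg less_irrefl mult_eq_0_iff)
  hence "B *\<^sub>v x = Re z \<cdot>\<^sub>v x" "B *\<^sub>v y = Re z \<cdot>\<^sub>v y" using Bx By xy by auto
  then obtain v where v: "v \<in> carrier_vec n" "v \<noteq> 0\<^sub>v n" "B *\<^sub>v v = Re z \<cdot>\<^sub>v v"
    using \<open>x \<noteq> 0\<^sub>v n \<or> y \<noteq> 0\<^sub>v n\<close> xy by blast
  define r where "r = 1 / sqrt (v \<bullet> v)"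
  have "(r \<cdot>\<^sub>v v) \<bullet> (r \<cdot>\<^sub>v v) = r\<^sup>2 * (v \<bullet> v)"
    using v(1) by (simp add: power2_eq_square mult.assoc)
  hence "(r \<cdot>\<^sub>v v) \<bullet> (r \<cdot>\<^sub>v v) = 1"
    using real_scalar_prod_self_pos[OF v(1,2)] by (simp add: r_def power_divide)
  moreover have "B *\<^sub>v (r \<cdot>\<^sub>v v) = Re z \<cdot>\<^sub>v (r \<cdot>\<^sub>v v)"
    using v B by (simp add: mult_mat_vec[of _ n n] smult_smult_assoc mult.commute)
  ultimately show ?thesis using v(1) by (intro exI[of _ "Re z"] exI[of _ "r \<cdot>\<^sub>v v"]) auto
qed

text \<open>The reflection exchanging \<open>v\<close> and the first unit vector completes \<open>v\<close> to an orthonormal basis and,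
being its own inverse and transpose, keeps the deflation step below short.\<close>

lemma householder_reflection:
  fixes v :: "real vec"
  assumes v: "v \<in> carrier_vec n" "v \<bullet> v = 1" and n: "0 < n"
  shows "\<exists>W. W \<in> carrier_mat n n \<and> transpose_mat W = W \<and> W * W = 1\<^sub>m n \<and>
    W *\<^sub>v unit_vec n 0 = v"
proof (cases "v = unit_vec n 0")
  case True
  then show ?thesis by (intro exI[of _ "1\<^sub>m n"]) auto
next
  case False
  define w where "w = v - unit_vec n 0"
  have w: "w \<in> carrier_vec n" using v by (auto simp: w_def)
  have "w \<noteq> 0\<^sub>v n"
  proof
    assume "w = 0\<^sub>v n"
    hence "v $ i = unit_vec n 0 $ i" if "i < n" for i
      using that v unfolding w_def by (metis (no_types) carrier_vecD eq_iff_diff_eq_0 index_minus_vec(1) index_unit_vec(3) index_zero_vec(1))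
    thus False using False v by (metis carrier_vecD eq_vecI index_unit_vec(3))
  qed
  hence ww: "0 < w \<bullet> w" by (rule real_scalar_prod_self_pos[OF w])
  define c where "c = 2 / (w \<bullet> w)"
  define W where "W = mat n n (\<lambda>(i, j). (if i = j then 1 else 0) - c * w $ i * w $ j)"
  have W: "W \<in> carrier_mat n n" by (simp add: W_def)
  have "W * W = 1\<^sub>m n"
  proof (rule eq_matI)
    fix i j assume "i < dim_row (1\<^sub>m n :: real mat)" "j < dim_col (1\<^sub>m n :: real mat)"
    hence ij: "i < n" "j < n" by auto
    have "(W * W) $$ (i, j) = (\<Sum>l<n. ((if i = l then 1 else 0) - c * w $ i * w $ l) *
        ((if l = j then 1 else 0) - c * w $ l * w $ j))"
      using ij by (simp add: W_def scalar_prod_sum[of _ n])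
    also have "\<dots> = (\<Sum>l<n. (if l = i then (if i = j then 1 else 0) - c * w $ i * w $ j else 0)
        - (if l = j then c * w $ i * w $ j else 0) + (c * c * w $ i * w $ j) * (w $ l * w $ l))"
      by (rule sum.cong) (auto simp: algebra_simps)
    also have "\<dots> = (if i = j then 1 else 0) - 2 * c * w $ i * w $ j
        + (c * c * w $ i * w $ j) * (w \<bullet> w)"
      using ij by (simp add: sum.distrib sum_subtractf sum_distrib_left[symmetric] scalar_prod_sum[OF w])
    also have "\<dots> = (if i = j then 1 else 0)"
      using ww by (simp add: c_def)
    finally show "(W * W) $$ (i, j) = 1\<^sub>m n $$ (i, j)" using ij by simp
  qed (auto simp: W_def)
  moreover have "transpose_mat W = W" by (rule eq_matI) (auto simp: W_def)
  moreover have "W *\<^sub>v unit_vec n 0 = v"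
  proof (rule eq_vecI)
    fix i assume "i < dim_vec v"
    hence i: "i < n" using v by simp
    have "w \<bullet> w = v \<bullet> v - 2 * v $ 0 + 1"
    proof -
      have "w \<bullet> w = (\<Sum>l<n. v $ l * v $ l - (if l = 0 then 2 * v $ 0 else 0) + (if l = 0 then 1 else 0))"
        unfolding scalar_prod_sum[OF w] using v
        by (intro sum.cong) (auto simp: w_def algebra_simps)
      thus ?thesis using n by (simp add: sum.distrib sum_subtractf scalar_prod_sum[OF v(1)])
    qed
    hence ww2: "w \<bullet> w = - 2 * w $ 0" using v n by (simp add: w_def)
    have "(W *\<^sub>v unit_vec n 0) $ i = W $$ (i, 0)" using i n W by simp
    also have "\<dots> = (if i = 0 then 1 else 0) - c * w $ 0 * w $ i" using i n by (simp add: W_def)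
    also have "c * w $ 0 = - 1" using ww unfolding c_def ww2 by (simp add: field_simps)
    finally show "(W *\<^sub>v unit_vec n 0) $ i = v $ i" using i n v by (simp add: w_def)
  qed (use v in \<open>auto simp: W_def\<close>)
  ultimately show ?thesis using W by blast
qed

text \<open>Deflation: in an orthonormal basis that starts with an eigenvector, the first column of the matrix
vanishes below the diagonal, by symmetry so does the first row, and the induction hypothesis applies
to the remaining block.\<close>

lemma symmetric_diagonalizable:
  fixes B :: "real mat"
  assumes "B \<in> carrier_mat n n" "transpose_mat B = B"
  shows "\<exists>P d. P \<in> carrier_mat n n \<and> transpose_mat P * P = 1\<^sub>m n \<and>
    transpose_mat P * B * P = mat_diag n d"
  using assms
proof (induction n arbitrary: B)
  case 0
  show ?case by (rule exI[of _ "1\<^sub>m 0"]) (use 0 in \<open>auto simp: mat_diag_def intro!: eq_matI\<close>)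
next
  case (Suc n)
  note B = Suc.prems(1)
  obtain c v where v: "v \<in> carrier_vec (Suc n)" "v \<bullet> v = 1" "B *\<^sub>v v = c \<cdot>\<^sub>v v"
    using symmetric_real_eigenvector[OF Suc.prems] by auto
  obtain W where W: "W \<in> carrier_mat (Suc n) (Suc n)" "transpose_mat W = W"
    "W * W = 1\<^sub>m (Suc n)" "W *\<^sub>v unit_vec (Suc n) 0 = v"
    using householder_reflection[OF v(1,2)] by auto
  define M where "M = W * B * W"
  have M: "M \<in> carrier_mat (Suc n) (Suc n)" using W B by (simp add: M_def)
  have Msym: "transpose_mat M = M"
    using congruence_symmetric[OF B W(1) Suc.prems(2)] W(2) by (simp add: M_def)
  have "W *\<^sub>v v = (W * W) *\<^sub>v unit_vec (Suc n) 0"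
    unfolding W(4)[symmetric] using W(1) by (simp del: W(3))
  hence Wv: "W *\<^sub>v v = unit_vec (Suc n) 0" unfolding W(3) by simp
  have Me: "M *\<^sub>v unit_vec (Suc n) 0 = c \<cdot>\<^sub>v unit_vec (Suc n) 0"
    using mult3_mat_vec[OF W(1) B W(1), of "unit_vec (Suc n) 0"] W(1,4) v Wv
    by (simp add: M_def mult_mat_vec[of _ "Suc n" "Suc n"] del: assoc_mult_mat)
  have M0: "M $$ (i, 0) = (if i = 0 then c else 0)" if "i < Suc n" for i
  proof -
    have "M $$ (i, 0) = (M *\<^sub>v unit_vec (Suc n) 0) $ i" using M that by simp
    thus ?thesis unfolding Me using that by simp
  qed
  have M0': "M $$ (0, i) = (if i = 0 then c else 0)" if "i < Suc n" for i
    using M0[OF that] Msym M that by (metis carrier_matD index_transpose_mat(1) zero_less_Suc)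
  define M' where "M' = mat n n (\<lambda>(i, j). M $$ (Suc i, Suc j))"
  have M': "M' \<in> carrier_mat n n" by (simp add: M'_def)
  have "M $$ (i, j) = M $$ (j, i)" if "i < Suc n" "j < Suc n" for i j
    using Msym M that by (metis carrier_matD index_transpose_mat(1))
  hence "transpose_mat M' = M'" by (intro eq_matI) (auto simp: M'_def)
  then obtain P' d' where P': "P' \<in> carrier_mat n n" "transpose_mat P' * P' = 1\<^sub>m n"
    "transpose_mat P' * M' * P' = mat_diag n d'"
    using Suc.IH[OF M'] by blast
  define C where "C = mat 1 1 (\<lambda>_. c)"
  have C: "C \<in> carrier_mat 1 1" by (simp add: C_def)
  have Mb: "M = four_block_mat C (0\<^sub>m 1 n) (0\<^sub>m n 1) M'"
    by (rule eq_matI) (use M M0 M0' in \<open>auto simp: M'_def C_def\<close>)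
  define F where "F = four_block_mat (1\<^sub>m 1) (0\<^sub>m 1 n) (0\<^sub>m n 1) P'"
  have F: "F \<in> carrier_mat (Suc n) (Suc n)" using P' by (simp add: F_def four_block_carrier_mat[of _ 1 1 _ n n, simplified])
  have Ft: "transpose_mat F = four_block_mat (1\<^sub>m 1) (0\<^sub>m 1 n) (0\<^sub>m n 1) (transpose_mat P')"
    using P' unfolding F_def by (subst transpose_four_block_mat[of _ 1 1 _ n _ n]) auto
  have FF: "transpose_mat F * F = 1\<^sub>m (Suc n)"
  proof -
    have "transpose_mat F * F = four_block_mat (1\<^sub>m 1) (0\<^sub>m 1 n) (0\<^sub>m n 1) (1\<^sub>m n)"
      unfolding Ft unfolding F_def using P'
      by (subst mult_four_block_mat[of _ 1 1 _ n _ n _ _ 1 _ n]) auto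
    also have "\<dots> = 1\<^sub>m (1 + n)" by (rule four_block_one_mat)
    finally show ?thesis by simp
  qed
  have FMF: "transpose_mat F * M * F = mat_diag (Suc n) (case_nat c d')"
  proof -
    have "transpose_mat F * M = four_block_mat C (0\<^sub>m 1 n) (0\<^sub>m n 1) (transpose_mat P' * M')"
      unfolding Ft Mb using P' M' C
      by (subst mult_four_block_mat[of _ 1 1 _ n _ n _ _ 1 _ n]) auto
    hence "transpose_mat F * M * F
        = four_block_mat C (0\<^sub>m 1 n) (0\<^sub>m n 1) (transpose_mat P' * M') * F" by simp
    also have "\<dots> = four_block_mat C (0\<^sub>m 1 n) (0\<^sub>m n 1) (transpose_mat P' * M' * P')"
      unfolding F_def using P'(1) M' C
      by (subst mult_four_block_mat[of _ 1 1 _ n _ n _ _ 1 _ n]) auto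
    also have "\<dots> = four_block_mat C (0\<^sub>m 1 n) (0\<^sub>m n 1) (mat_diag n d')"
      unfolding P'(3) ..
    also have "\<dots> = mat_diag (Suc n) (case_nat c d')"
      by (rule eq_matI) (auto simp: C_def mat_diag_def split: nat.split)
    finally show ?thesis .
  qed
  define P where "P = W * F"
  have P: "P \<in> carrier_mat (Suc n) (Suc n)" using W F by (simp add: P_def)
  have Pt: "transpose_mat P = transpose_mat F * W"
    unfolding P_def using transpose_mult[OF W(1) F] W(2) by simp
  have "transpose_mat P * P = transpose_mat F * (W * W) * F"
    unfolding Pt unfolding P_def using W(1) F
    by (simp add: assoc_mult_mat[of _ "Suc n" "Suc n" _ "Suc n" _ "Suc n"] del: W(3))
  hence "transpose_mat P * P = 1\<^sub>m (Suc n)" unfolding W(3) using F FF by simp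
  moreover have "transpose_mat P * B * P = transpose_mat F * M * F"
    unfolding Pt M_def unfolding P_def using W(1) F B
    by (simp add: assoc_mult_mat[of _ "Suc n" "Suc n" _ "Suc n" _ "Suc n"])
  ultimately show ?case using P FMF by metis
qed

lemma eigval_of_sorted_diagonalization:
  assumes B: "B \<in> carrier_mat n n" and P: "P \<in> carrier_mat n n" "transpose_mat P * P = 1\<^sub>m n"
    and D: "transpose_mat P * B * P = mat_diag n d"
    and srt: "\<And>i j. i \<le> j \<Longrightarrow> j < n \<Longrightarrow> d j \<le> d i" and k: "k \<in> {1..n}"
  shows "eigval k B = d (k - 1)"
proof -
  note PPt = orthogonal_transpose[OF P]
  have "P * mat_diag n d * transpose_mat P = (P * transpose_mat P) * B * (P * transpose_mat P)"
    unfolding D[symmetric] using P(1) B by (simp add: assoc_mult_mat[of _ n n _ n _ n] del: PPt P(2))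
  hence "B = P * mat_diag n d * transpose_mat P" unfolding PPt using B by simp
  hence "similar_mat B (mat_diag n d)"
    unfolding similar_mat_def similar_mat_wit_def Let_def using B P PPt
    by (intro exI[of _ P] exI[of _ "transpose_mat P"]) auto
  hence "char_poly B = char_poly (mat_diag n d)" by (rule char_poly_similar)
  also have "\<dots> = (\<Prod>a\<leftarrow>diag_mat (mat_diag n d). [:- a, 1:])"
    by (rule char_poly_upper_triangular[of _ n]) (auto simp: mat_diag_def)
  also have "diag_mat (mat_diag n d) = map d [0..<n]"
    by (auto simp: diag_mat_def mat_diag_def)
  finally have cp: "char_poly B = (\<Prod>a\<leftarrow>map d [0..<n]. [:- a, 1:])" .
  have roots: "proots (\<Prod>a\<leftarrow>xs. [:- a, 1:]) = mset xs" for xs :: "real list"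
  proof (induction xs)
    case (Cons a xs)
    have "(\<Prod>a\<leftarrow>xs. [:- a, 1:]) \<noteq> 0" by (auto simp: prod_list_zero_iff)
    thus ?case using Cons by (simp add: proots_mult del: mult_pCons_left)
  qed simp
  have "sort (map d [0..<n]) = rev (map d [0..<n])"
  proof (rule properties_for_sort)
    show "sorted (rev (map d [0..<n]))"
      unfolding sorted_iff_nth_mono
      by (auto simp: rev_nth intro!: srt)
  qed simp
  hence "kth_largest k (sort (map d [0..<n])) = map d [0..<n] ! (k - 1)"
    unfolding kth_largest_def sorted_sort_id[OF sorted_sort] by (simp only: rev_rev_ident)
  thus ?thesis using k unfolding eigval_def cp roots sorted_list_of_multiset_mset by auto
qed

theorem sorted_spectral_decomposition:
  fixes B :: "real mat"
  assumes B: "B \<in> carrier_mat n n" "transpose_mat B = B"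
  obtains P d where "P \<in> carrier_mat n n" "transpose_mat P * P = 1\<^sub>m n"
    "transpose_mat P * B * P = mat_diag n d"
    "\<And>i j. i \<le> j \<Longrightarrow> j < n \<Longrightarrow> d j \<le> d i"
    "\<And>k. k \<in> {1..n} \<Longrightarrow> eigval k B = d (k - 1)"
proof -
  obtain P0 d0 where P0: "P0 \<in> carrier_mat n n" "transpose_mat P0 * P0 = 1\<^sub>m n"
    "transpose_mat P0 * B * P0 = mat_diag n d0"
    using symmetric_diagonalizable[OF B] by blast
  define idx where "idx = rev (sort_key d0 [0..<n])"
  define f where "f i = idx ! i" for i
  have len: "length idx = n" and set_is: "set idx = {..<n}" and dist: "distinct idx"
    by (auto simp: idx_def)
  have f: "f i < n" if "i < n" for i using that len set_is nth_mem unfolding f_def by fastforce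
  have inj: "f i = f j \<longleftrightarrow> i = j" if "i < n" "j < n" for i j
    using that len dist unfolding f_def by (simp add: nth_eq_iff_index_eq)
  define P where "P = mat n n (\<lambda>(i, j). P0 $$ (i, f j))"
  define d where "d i = d0 (f i)" for i
  have P: "P \<in> carrier_mat n n" by (simp add: P_def)
  have colP: "col P j = col P0 (f j)" if "j < n" for j
    using that f[OF that] P0(1) by (intro eq_vecI) (auto simp: P_def)
  have 1: "transpose_mat P * P = 1\<^sub>m n"
  proof (rule eq_matI)
    fix i j assume "i < dim_row (1\<^sub>m n :: real mat)" "j < dim_col (1\<^sub>m n :: real mat)"
    hence ij: "i < n" "j < n" by auto
    have "(transpose_mat P * P) $$ (i, j) = (transpose_mat P0 * P0) $$ (f i, f j)"
      using ij f P P0(1) by (simp add: colP del: P0(2))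
    thus "(transpose_mat P * P) $$ (i, j) = 1\<^sub>m n $$ (i, j)"
      unfolding P0(2) using ij f inj by simp
  qed (use P in auto)
  have 2: "transpose_mat P * B * P = mat_diag n d"
  proof (rule eq_matI)
    fix i j assume "i < dim_row (mat_diag n d)" "j < dim_col (mat_diag n d)"
    hence ij: "i < n" "j < n" by (auto simp: mat_diag_def)
    have "(transpose_mat P * B * P) $$ (i, j) = (transpose_mat P0 * B * P0) $$ (f i, f j)"
      using ij f by (simp add: colP congruence_index[OF B(1) P] congruence_index[OF B(1) P0(1)]
          del: assoc_mult_mat)
    thus "(transpose_mat P * B * P) $$ (i, j) = mat_diag n d $$ (i, j)"
      unfolding P0(3) using ij f inj by (simp add: mat_diag_def d_def)
  qed (use P B in \<open>auto simp: mat_diag_def\<close>)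
  have 3: "d j \<le> d i" if "i \<le> j" "j < n" for i j
  proof -
    have "sorted (map d0 (sort_key d0 [0..<n]))" by simp
    hence "sorted (map d0 (rev idx))" by (simp add: idx_def)
    hence "map d0 (rev idx) ! (n - 1 - j) \<le> map d0 (rev idx) ! (n - 1 - i)"
      using that len by (intro sorted_nth_mono) auto
    thus ?thesis using that len by (simp add: rev_nth d_def f_def)
  qed
  show ?thesis
    by (rule that[OF P 1 2 3 eigval_of_sorted_diagonalization[OF B(1) P 1 2 3]])
qed


lemma orthogonal_expansion:
  fixes P :: "real mat"
  assumes P: "P \<in> carrier_mat n n" "transpose_mat P * P = 1\<^sub>m n" and x: "x \<in> carrier_vec n"
  shows "P *\<^sub>v (transpose_mat P *\<^sub>v x) = x"
proof -
  have "P *\<^sub>v (transpose_mat P *\<^sub>v x) = (P * transpose_mat P) *\<^sub>v x"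
    using P(1) x by (intro assoc_mult_mat_vec[symmetric, of _ n n _ n]) auto
  thus ?thesis unfolding orthogonal_transpose[OF P] using x by simp
qed

lemma quad_diagonalized:
  assumes "B \<in> carrier_mat n n" "P \<in> carrier_mat n n" "transpose_mat P * B * P = mat_diag n d"
    "a \<in> carrier_vec n"
  shows "quad B (P *\<^sub>v a) = (\<Sum>i<n. d i * (a $ i)\<^sup>2)"
  using quad_congruence[OF assms(1,2,4)] quad_diag[OF assms(4)] unfolding assms(3) by simp

lemma rayleigh_bounds:
  assumes B: "B \<in> carrier_mat n n" "transpose_mat B = B" and x: "x \<in> carrier_vec n"
  shows "eigval n B * (x \<bullet> x) \<le> quad B x" and "quad B x \<le> eigval 1 B * (x \<bullet> x)"
proof -
  obtain P d where P: "P \<in> carrier_mat n n" "transpose_mat P * P = 1\<^sub>m n"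
    and D: "transpose_mat P * B * P = mat_diag n d"
    and srt: "\<And>i j. i \<le> j \<Longrightarrow> j < n \<Longrightarrow> d j \<le> d i"
    and ev: "\<And>k. k \<in> {1..n} \<Longrightarrow> eigval k B = d (k - 1)"
    by (rule sorted_spectral_decomposition[OF B]) blast
  define a where "a = transpose_mat P *\<^sub>v x"
  have a: "a \<in> carrier_vec n" "x = P *\<^sub>v a"
    using P x orthogonal_expansion[OF P x] by (auto simp: a_def)
  have xx: "x \<bullet> x = (\<Sum>i<n. (a $ i)\<^sup>2)"
    unfolding a(2) orthogonal_scalar_prod[OF P a(1)] by (rule scalar_prod_self_sum[OF a(1)])
  have qx: "quad B x = (\<Sum>i<n. d i * (a $ i)\<^sup>2)"
    unfolding a(2) by (rule quad_diagonalized[OF B(1) P(1) D a(1)])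
  have n: "i < n \<Longrightarrow> eigval n B = d (n - 1) \<and> eigval 1 B = d 0" for i
    using ev[of n] ev[of 1] by auto
  show "eigval n B * (x \<bullet> x) \<le> quad B x"
    unfolding xx qx sum_distrib_left
    by (intro sum_mono mult_right_mono) (auto simp: n intro: srt)
  show "quad B x \<le> eigval 1 B * (x \<bullet> x)"
    unfolding xx qx sum_distrib_left
    by (intro sum_mono mult_right_mono) (use n srt in auto)
qed

lemma spd_eigval_pos:
  assumes B: "spd n B" and k: "k \<in> {1..n}"
  shows "0 < eigval k B"
proof -
  have B': "B \<in> carrier_mat n n" "transpose_mat B = B" using B by (auto simp: spd_def)
  obtain P d where P: "P \<in> carrier_mat n n" "transpose_mat P * P = 1\<^sub>m n"
    and D: "transpose_mat P * B * P = mat_diag n d"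
    and ev: "\<And>k. k \<in> {1..n} \<Longrightarrow> eigval k B = d (k - 1)"
    by (rule sorted_spectral_decomposition[OF B']) blast
  define a :: "real vec" where "a = unit_vec n (k - 1)"
  have a: "a \<in> carrier_vec n" by (simp add: a_def)
  have "quad B (P *\<^sub>v a) = (\<Sum>i<n. d i * (a $ i)\<^sup>2)"
    by (rule quad_diagonalized[OF B'(1) P(1) D a])
  also have "\<dots> = (\<Sum>i<n. if i = k - 1 then d i else 0)"
    using k by (intro sum.cong) (auto simp: a_def)
  also have "\<dots> = d (k - 1)" using k by auto
  finally have q: "quad B (P *\<^sub>v a) = eigval k B" using ev[OF k] by simp
  have "(P *\<^sub>v a) \<bullet> (P *\<^sub>v a) = 1"
  proof -
    have "k - 1 < n" using k by auto
    thus ?thesis unfolding orthogonal_scalar_prod[OF P a] unfolding a_def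
      using scalar_prod_left_unit[of "unit_vec n (k - 1)" n "k - 1"] by simp
  qed
  hence "P *\<^sub>v a \<noteq> 0\<^sub>v n" by auto
  moreover have "P *\<^sub>v a \<in> carrier_vec n" using P(1) a by auto
  ultimately show ?thesis using B q unfolding spd_def by metis
qed

section \<open>Comparison of eigenvalues\<close>

lemma singular_if_zero_row:
  fixes K :: "real mat"
  assumes K: "K \<in> carrier_mat n n" and i: "i < n" "\<And>j. j < n \<Longrightarrow> K $$ (i, j) = 0"
  obtains a where "a \<in> carrier_vec n" "a \<noteq> 0\<^sub>v n" "K *\<^sub>v a = 0\<^sub>v n"
proof -
  have Kt: "transpose_mat K \<in> carrier_mat n n" using K by simp
  have "transpose_mat K *\<^sub>v unit_vec n i = 0\<^sub>v n"
    using K i by (intro eq_vecI) auto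
  moreover have "unit_vec n i \<noteq> (0\<^sub>v n :: real vec)"
    using i by (metis index_unit_vec(1) index_zero_vec(1) zero_neq_one)
  ultimately have "det (transpose_mat K) = 0"
    unfolding det_0_iff_vec_prod_zero_field[OF Kt] by (intro exI[of _ "unit_vec n i"]) auto
  hence "det K = 0" using det_transpose[OF K] by simp
  thus ?thesis using that unfolding det_0_iff_vec_prod_zero_field[OF K] by blast
qed

text \<open>The Courant-Fischer argument. On the span of the first \<open>k\<close> eigenvectors of \<open>B\<close> the Rayleigh quotient
of \<open>B\<close> is at least \<open>\<lambda>\<^sub>k(B)\<close>, and on the span of the eigenvectors \<open>k, \<dots>, n\<close> of \<open>C\<close> that of \<open>C\<close> is at most
\<open>\<lambda>\<^sub>k(C)\<close>. The dimensions of these two spaces add up to \<open>n + 1\<close>, so there is some \<open>x \<noteq> 0\<close> in the first one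
for which \<open>S x\<close> lies in the second one, and the assumed inequality is applied to this \<open>x\<close>. In the
coordinates \<open>a\<close> of \<open>x\<close> these are \<open>k - 1\<close> equations, saying that \<open>S x\<close> has no component along the first
\<open>k - 1\<close> eigenvectors of \<open>C\<close>, together with the \<open>n - k\<close> equations \<open>a\<^sub>i = 0\<close> for the last \<open>n - k\<close>
coordinates. They are collected in a square matrix with one zero row, which is therefore singular.\<close>

theorem eigval_comparison:
  assumes B: "B \<in> carrier_mat n n" "transpose_mat B = B"
    and C: "C \<in> carrier_mat n n" "transpose_mat C = C"
    and S: "S \<in> carrier_mat n n" and b: "0 \<le> \<beta>" and k: "k \<in> {1..n}"
    and inj: "\<And>x. x \<in> carrier_vec n \<Longrightarrow> x \<noteq> 0\<^sub>v n \<Longrightarrow> S *\<^sub>v x \<noteq> 0\<^sub>v n"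
    and le: "\<And>x. x \<in> carrier_vec n \<Longrightarrow>
      quad B x * ((S *\<^sub>v x) \<bullet> (S *\<^sub>v x)) \<le> \<beta> * quad C (S *\<^sub>v x) * (x \<bullet> x)"
  shows "eigval k B \<le> \<beta> * eigval k C"
proof -
  obtain P d where P: "P \<in> carrier_mat n n" "transpose_mat P * P = 1\<^sub>m n"
    and D: "transpose_mat P * B * P = mat_diag n d"
    and d: "\<And>i j. i \<le> j \<Longrightarrow> j < n \<Longrightarrow> d j \<le> d i"
    and evB: "\<And>k. k \<in> {1..n} \<Longrightarrow> eigval k B = d (k - 1)"
    by (rule sorted_spectral_decomposition[OF B]) blast
  obtain R e where R: "R \<in> carrier_mat n n" "transpose_mat R * R = 1\<^sub>m n"
    and E: "transpose_mat R * C * R = mat_diag n e"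
    and e: "\<And>i j. i \<le> j \<Longrightarrow> j < n \<Longrightarrow> e j \<le> e i"
    and evC: "\<And>k. k \<in> {1..n} \<Longrightarrow> eigval k C = e (k - 1)"
    by (rule sorted_spectral_decomposition[OF C]) blast
  define N where "N = transpose_mat R * S * P"
  have N: "N \<in> carrier_mat n n" using R S P by (simp add: N_def)
  \<comment> \<open>row \<open>k - 1\<close> is left zero; the other rows are the \<open>n - 1\<close> equations for the coordinates\<close>
  define K where "K = mat n n (\<lambda>(i, j). if i < k - 1 then N $$ (i, j)
    else if k \<le> i \<and> i = j then 1 else 0)"
  have K: "K \<in> carrier_mat n n" by (simp add: K_def)
  obtain a where a: "a \<in> carrier_vec n" "a \<noteq> 0\<^sub>v n" "K *\<^sub>v a = 0\<^sub>v n"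
  proof (rule singular_if_zero_row[OF K])
    show "k - 1 < n" using k by auto
    show "K $$ (k - 1, j) = 0" if "j < n" for j using that k by (auto simp: K_def)
  qed
  define x where "x = P *\<^sub>v a"
  define y where "y = S *\<^sub>v x"
  define c where "c = N *\<^sub>v a"
  have x: "x \<in> carrier_vec n" using P(1) a(1) by (simp add: x_def)
  have y: "y \<in> carrier_vec n" using S x by (simp add: y_def)
  have c: "c \<in> carrier_vec n" using N a(1) by (simp add: c_def)
  have yc: "y = R *\<^sub>v c"
  proof -
    have "c = transpose_mat R *\<^sub>v y"
      unfolding c_def N_def y_def x_def using R(1) S P(1) a(1) by (intro mult3_mat_vec) auto
    thus ?thesis using orthogonal_expansion[OF R y] by simp
  qed
  have Ka: "(K *\<^sub>v a) $ i = (\<Sum>j<n. K $$ (i, j) * a $ j)" if "i < n" for i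
    using that K a(1) by (simp add: scalar_prod_sum[of _ n])
  have a0: "a $ i = 0" if "k \<le> i" "i < n" for i
  proof -
    have "(\<Sum>j<n. K $$ (i, j) * a $ j) = (\<Sum>j<n. if i = j then a $ j else 0)"
      using that by (intro sum.cong) (auto simp: K_def)
    thus ?thesis using Ka[OF that(2)] a(3) that by simp
  qed
  have c0: "c $ i = 0" if "i < k - 1" "i < n" for i
  proof -
    have "c $ i = (\<Sum>j<n. K $$ (i, j) * a $ j)"
      using that N a(1) by (simp add: c_def K_def scalar_prod_sum[of _ n])
    thus ?thesis using Ka[OF that(2)] a(3) that by simp
  qed
  have xx: "x \<bullet> x = (\<Sum>i<n. (a $ i)\<^sup>2)"
    unfolding x_def orthogonal_scalar_prod[OF P a(1)] by (rule scalar_prod_self_sum[OF a(1)])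
  have yy: "y \<bullet> y = (\<Sum>i<n. (c $ i)\<^sup>2)"
    unfolding yc orthogonal_scalar_prod[OF R c] by (rule scalar_prod_self_sum[OF c])
  have "0 < a \<bullet> a" by (rule real_scalar_prod_self_pos[OF a(1,2)])
  hence x0: "0 < x \<bullet> x" unfolding x_def orthogonal_scalar_prod[OF P a(1)] .
  hence "x \<noteq> 0\<^sub>v n" by auto
  hence y0: "0 < y \<bullet> y" using inj[OF x] real_scalar_prod_self_pos[OF y] by (simp add: y_def)
  have "d (k - 1) * (x \<bullet> x) \<le> (\<Sum>i<n. d i * (a $ i)\<^sup>2)"
    unfolding xx sum_distrib_left
  proof (rule sum_mono)
    fix i assume "i \<in> {..<n}"
    hence i: "i < n" by simp
    show "d (k - 1) * (a $ i)\<^sup>2 \<le> d i * (a $ i)\<^sup>2"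
    proof (cases "k \<le> i")
      case True
      then show ?thesis using a0 i by simp
    next
      case False
      then show ?thesis using k by (intro mult_right_mono d) auto
    qed
  qed
  also have "\<dots> = quad B x" unfolding x_def by (rule quad_diagonalized[OF B(1) P(1) D a(1), symmetric])
  finally have 1: "d (k - 1) * (x \<bullet> x) \<le> quad B x" .
  have "quad C y = (\<Sum>i<n. e i * (c $ i)\<^sup>2)" unfolding yc by (rule quad_diagonalized[OF C(1) R(1) E c])
  also have "\<dots> \<le> e (k - 1) * (y \<bullet> y)"
    unfolding yy sum_distrib_left
  proof (rule sum_mono)
    fix i assume "i \<in> {..<n}"
    hence i: "i < n" by simp
    show "e i * (c $ i)\<^sup>2 \<le> e (k - 1) * (c $ i)\<^sup>2"
    proof (cases "i < k - 1")
      case True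
      then show ?thesis using c0 i by simp
    next
      case False
      then show ?thesis using i by (intro mult_right_mono e) auto
    qed
  qed
  finally have 2: "quad C y \<le> e (k - 1) * (y \<bullet> y)" .
  have "d (k - 1) * (x \<bullet> x) * (y \<bullet> y) \<le> quad B x * (y \<bullet> y)"
    using 1 y0 by (intro mult_right_mono) auto
  also have "\<dots> \<le> \<beta> * quad C y * (x \<bullet> x)" using le[OF x] by (simp add: y_def)
  also have "\<dots> \<le> \<beta> * (e (k - 1) * (y \<bullet> y)) * (x \<bullet> x)"
    using 2 b x0 by (intro mult_right_mono mult_left_mono) auto
  finally have "d (k - 1) * ((x \<bullet> x) * (y \<bullet> y)) \<le> (\<beta> * e (k - 1)) * ((x \<bullet> x) * (y \<bullet> y))"
    by (simp add: mult_ac)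
  thus ?thesis using x0 y0 evB[OF k] evC[OF k] by (simp add: mult_le_cancel_right)
qed

corollary eigval_mono_scaled:
  assumes B: "B \<in> carrier_mat n n" "transpose_mat B = B"
    and C: "C \<in> carrier_mat n n" "transpose_mat C = C"
    and b: "0 \<le> \<beta>" and k: "k \<in> {1..n}"
    and le: "\<And>x. x \<in> carrier_vec n \<Longrightarrow> quad B x \<le> \<beta> * quad C x"
  shows "eigval k B \<le> \<beta> * eigval k C"
proof (rule eigval_comparison[OF B C one_carrier_mat b k])
  fix x :: "real vec" assume x: "x \<in> carrier_vec n"
  show "quad B x * ((1\<^sub>m n *\<^sub>v x) \<bullet> (1\<^sub>m n *\<^sub>v x)) \<le> \<beta> * quad C (1\<^sub>m n *\<^sub>v x) * (x \<bullet> x)"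
    using mult_right_mono[OF le[OF x] real_scalar_prod_self_nonneg[of x]] x by simp
qed simp

lemma spd_quad_nonneg: "spd n B \<Longrightarrow> x \<in> carrier_vec n \<Longrightarrow> 0 \<le> quad B x"
  unfolding spd_def by (cases "x = 0\<^sub>v n") (force, metis less_imp_le)

text \<open>For the upper bound compare \<open>Q\<^sup>T A Q\<close> with \<open>A\<close> along \<open>Q\<close>, for the lower bound compare \<open>A\<close> with \<open>Q\<^sup>T A Q\<close>
along the inverse of \<open>Q\<close>.\<close>

lemma ostrowski:
  assumes A: "spd n A" and Q: "Q \<in> carrier_mat n n" and h: "h < 1"
    and near: "\<And>x. x \<in> carrier_vec n \<Longrightarrow>
      \<bar>(Q *\<^sub>v x) \<bullet> (Q *\<^sub>v x) - x \<bullet> x\<bar> \<le> h * (x \<bullet> x)"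
  shows "spd n (transpose_mat Q * A * Q)"
    and "k \<in> {1..n} \<Longrightarrow> (1 - h) * eigval k A \<le> eigval k (transpose_mat Q * A * Q)"
    and "k \<in> {1..n} \<Longrightarrow> eigval k (transpose_mat Q * A * Q) \<le> (1 + h) * eigval k A"
proof -
  let ?T = "transpose_mat Q * A * Q"
  have A': "A \<in> carrier_mat n n" "transpose_mat A = A" using A by (auto simp: spd_def)
  have T: "?T \<in> carrier_mat n n" using A' Q by simp
  have Tsym: "transpose_mat ?T = ?T" by (rule congruence_symmetric[OF A'(1) Q A'(2)])
  have qT: "quad ?T x = quad A (Q *\<^sub>v x)" if "x \<in> carrier_vec n" for x
    by (rule quad_congruence[OF A'(1) Q that])
  have Qx: "Q *\<^sub>v x \<in> carrier_vec n" if "x \<in> carrier_vec n" for x using Q that by simp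
  have lo: "(1 - h) * (x \<bullet> x) \<le> (Q *\<^sub>v x) \<bullet> (Q *\<^sub>v x)"
    and hi: "(Q *\<^sub>v x) \<bullet> (Q *\<^sub>v x) \<le> (1 + h) * (x \<bullet> x)" if "x \<in> carrier_vec n" for x
    using near[OF that] by (auto simp: algebra_simps abs_le_iff)
  have inj: "Q *\<^sub>v x \<noteq> 0\<^sub>v n" if "x \<in> carrier_vec n" "x \<noteq> 0\<^sub>v n" for x
  proof
    assume "Q *\<^sub>v x = 0\<^sub>v n"
    hence "(1 - h) * (x \<bullet> x) \<le> 0" using lo[OF that(1)] by simp
    moreover have "0 < (1 - h) * (x \<bullet> x)" using real_scalar_prod_self_pos[OF that] h by simp
    ultimately show False by simp
  qed
  show spdT: "spd n ?T"
    unfolding spd_def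
  proof (intro conjI ballI impI T Tsym)
    fix x :: "real vec" assume x: "x \<in> carrier_vec n" "x \<noteq> 0\<^sub>v n"
    show "0 < quad ?T x" unfolding qT[OF x(1)] using A inj[OF x] Qx[OF x(1)] unfolding spd_def by blast
  qed
  assume k: "k \<in> {1..n}"
  hence "0 < n" by auto
  have h0: "0 \<le> h"
    using near[of "unit_vec n 0"] \<open>0 < n\<close> by simp
  show "eigval k ?T \<le> (1 + h) * eigval k A"
  proof (rule eigval_comparison[OF T Tsym A' Q _ k inj])
    fix x :: "real vec" assume x: "x \<in> carrier_vec n"
    have "quad A (Q *\<^sub>v x) * ((Q *\<^sub>v x) \<bullet> (Q *\<^sub>v x)) \<le> quad A (Q *\<^sub>v x) * ((1 + h) * (x \<bullet> x))"
      by (rule mult_left_mono[OF hi[OF x] spd_quad_nonneg[OF A Qx[OF x]]])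
    thus "quad ?T x * ((Q *\<^sub>v x) \<bullet> (Q *\<^sub>v x)) \<le> (1 + h) * quad A (Q *\<^sub>v x) * (x \<bullet> x)"
      unfolding qT[OF x] by (simp add: mult_ac)
  qed (use h0 in auto)
  have "det Q \<noteq> 0" unfolding det_0_iff_vec_prod_zero_field[OF Q] using inj by blast
  then obtain S where S: "S \<in> carrier_mat n n" "Q * S = 1\<^sub>m n"
    using det_non_zero_imp_unit[OF Q, of "()"] unfolding Units_def ring_mat_def by auto
  have QS: "Q *\<^sub>v (S *\<^sub>v x) = x" if "x \<in> carrier_vec n" for x
    using assoc_mult_mat_vec[OF Q S(1) that] S(2) that by simp
  have "eigval k A \<le> (1 / (1 - h)) * eigval k ?T"
  proof (rule eigval_comparison[OF A' T Tsym S(1) _ k])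
    fix x :: "real vec" assume x: "x \<in> carrier_vec n"
    have Sx: "S *\<^sub>v x \<in> carrier_vec n" using S x by simp
    have "(S *\<^sub>v x) \<bullet> (S *\<^sub>v x) \<le> (1 / (1 - h)) * (x \<bullet> x)"
      using lo[OF Sx] h unfolding QS[OF x] by (simp add: field_simps)
    hence "quad A x * ((S *\<^sub>v x) \<bullet> (S *\<^sub>v x)) \<le> quad A x * ((1 / (1 - h)) * (x \<bullet> x))"
      by (rule mult_left_mono[OF _ spd_quad_nonneg[OF A x]])
    thus "quad A x * ((S *\<^sub>v x) \<bullet> (S *\<^sub>v x)) \<le> (1 / (1 - h)) * quad ?T (S *\<^sub>v x) * (x \<bullet> x)"
      unfolding qT[OF Sx] QS[OF x] by (simp add: mult_ac)
  next
    fix x :: "real vec" assume "x \<in> carrier_vec n" "x \<noteq> 0\<^sub>v n"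
    moreover have "Q *\<^sub>v 0\<^sub>v n = 0\<^sub>v n" using Q by (intro eq_vecI) auto
    ultimately show "S *\<^sub>v x \<noteq> 0\<^sub>v n" using QS[of x] by auto
  qed (use h in auto)
  thus "(1 - h) * eigval k A \<le> eigval k ?T" using h by (simp add: field_simps)
qed

section \<open>Scaling to unit diagonal\<close>

text \<open>The matrix whose condition number is \<open>scaled_cond2 B\<close>, written with a transposed left factor so that
it is an instance of the congruences treated above.\<close>

definition unit_diag :: "nat \<Rightarrow> real mat \<Rightarrow> real mat" where
  "unit_diag n B = (let D = mat_diag n (\<lambda>i. 1 / sqrt (B $$ (i, i))) in transpose_mat D * B * D)"

lemma mat_diag_transpose: "transpose_mat (mat_diag n d) = mat_diag n d"
  by (rule eq_matI) (auto simp: mat_diag_def)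

lemma scaled_cond2_unit_diag:
  assumes "B \<in> carrier_mat n n"
  shows "scaled_cond2 B = eigval 1 (unit_diag n B) / eigval n (unit_diag n B)"
proof -
  have "dim_row (mat_diag n d) = n" for d :: "nat \<Rightarrow> real" by (simp add: mat_diag_def)
  thus ?thesis using assms
    unfolding scaled_cond2_def cond2_def unit_diag_def Let_def mat_diag_transpose by simp
qed

lemma quad_unit_vec:
  assumes "B \<in> carrier_mat n n" "i < n"
  shows "quad B (unit_vec n i) = B $$ (i, i)"
  using assms by simp

lemma spd_diag_pos:
  assumes "spd n B" "i < n"
  shows "0 < B $$ (i, i)"
proof -
  have "unit_vec n i \<noteq> (0\<^sub>v n :: real vec)"
    using assms(2) by (metis index_unit_vec(1) index_zero_vec(1) zero_neq_one)
  thus ?thesis using assms quad_unit_vec[of B n i] unfolding spd_def by (metis unit_vec_carrier)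
qed

lemma unit_diag:
  assumes B: "spd n B"
  shows "unit_diag n B \<in> carrier_mat n n" "transpose_mat (unit_diag n B) = unit_diag n B"
    and "x \<in> carrier_vec n \<Longrightarrow>
      quad (unit_diag n B) x = quad B (vec n (\<lambda>i. x $ i / sqrt (B $$ (i, i))))"
    and "spd n (unit_diag n B)"
    and "i < n \<Longrightarrow> unit_diag n B $$ (i, i) = 1"
proof -
  have B': "B \<in> carrier_mat n n" "transpose_mat B = B" using B by (auto simp: spd_def)
  let ?D = "mat_diag n (\<lambda>i. 1 / sqrt (B $$ (i, i)))"
  have D: "?D \<in> carrier_mat n n" by simp
  show U: "unit_diag n B \<in> carrier_mat n n" unfolding unit_diag_def Let_def
    using B' D by (intro mult_carrier_mat[of _ n n]) auto
  show sym: "transpose_mat (unit_diag n B) = unit_diag n B"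
    unfolding unit_diag_def Let_def by (rule congruence_symmetric[OF B'(1) D B'(2)])
  show q: "quad (unit_diag n B) x = quad B (vec n (\<lambda>i. x $ i / sqrt (B $$ (i, i))))"
    if "x \<in> carrier_vec n" for x
    unfolding unit_diag_def Let_def quad_congruence[OF B'(1) D that] diag_mult_vec[OF that]
    by simp
  show "spd n (unit_diag n B)"
    unfolding spd_def
  proof (intro conjI ballI impI U sym)
    fix x :: "real vec" assume x: "x \<in> carrier_vec n" "x \<noteq> 0\<^sub>v n"
    let ?y = "vec n (\<lambda>i. x $ i / sqrt (B $$ (i, i)))"
    obtain i where i: "i < n" "x $ i \<noteq> 0" using x by (metis carrier_vecD eq_vecI index_zero_vec)
    hence "?y $ i \<noteq> 0" using spd_diag_pos[OF B i(1)] by simp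
    hence "?y \<noteq> 0\<^sub>v n" using i(1) by (metis index_zero_vec(1))
    moreover have "?y \<in> carrier_vec n" by simp
    ultimately have "0 < quad B ?y" using B unfolding spd_def by blast
    thus "0 < quad (unit_diag n B) x" unfolding q[OF x(1)] .
  qed
  assume i: "i < n"
  have c: "col ?D i = (1 / sqrt (B $$ (i, i))) \<cdot>\<^sub>v unit_vec n i"
    using i by (intro eq_vecI) (auto simp: mat_diag_def)
  have "unit_diag n B $$ (i, i) = (1 / sqrt (B $$ (i, i)))\<^sup>2 * B $$ (i, i)"
    unfolding unit_diag_def Let_def congruence_index[OF B'(1) D i i] c
    using B'(1) i by (simp add: mult_mat_vec[of _ n n] power2_eq_square)
  thus "unit_diag n B $$ (i, i) = 1" using spd_diag_pos[OF B i] by (simp add: power_divide)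
qed

text \<open>The diagonal entries of the scaled matrix are values of its Rayleigh quotient, so \<open>1\<close> lies between
the extreme eigenvalues. This makes the scaled condition number a bound for the inverse of the
smallest one.\<close>

lemma eigval_unit_diag_bounds:
  assumes B: "spd n B" and n: "0 < n"
  shows "0 < eigval n (unit_diag n B)" "eigval n (unit_diag n B) \<le> 1" "1 \<le> eigval 1 (unit_diag n B)"
    and "1 \<le> scaled_cond2 B" "1 / eigval n (unit_diag n B) \<le> scaled_cond2 B"
proof -
  show 1: "0 < eigval n (unit_diag n B)" using spd_eigval_pos[OF unit_diag(4)[OF B]] n by simp
  have q: "quad (unit_diag n B) (unit_vec n 0) = 1"
    using quad_unit_vec[OF unit_diag(1)[OF B] n] unit_diag(5)[OF B n] by simp
  show 2: "eigval n (unit_diag n B) \<le> 1" "1 \<le> eigval 1 (unit_diag n B)"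
    using rayleigh_bounds[OF unit_diag(1,2)[OF B], of "unit_vec n 0"] n unfolding q by simp_all
  have "B \<in> carrier_mat n n" using B by (simp add: spd_def)
  thus "1 \<le> scaled_cond2 B" "1 / eigval n (unit_diag n B) \<le> scaled_cond2 B"
    using 1 2 by (simp_all add: scaled_cond2_unit_diag divide_right_mono)
qed

text \<open>The scalings of \<open>B\<close> and \<open>C\<close> differ, so their scaled matrices are compared along the diagonal
substitution \<open>x\<^sub>i \<mapsto> x\<^sub>i \<surd>(C\<^sub>i\<^sub>i / B\<^sub>i\<^sub>i)\<close>; the bound on the diagonals limits how much it lengthens \<open>x\<close>.\<close>

lemma eigval_unit_diag_mono:
  assumes B: "spd n B" and C: "spd n C" and ab: "0 \<le> \<alpha>" "0 \<le> \<beta>" and k: "k \<in> {1..n}"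
    and le: "\<And>x. x \<in> carrier_vec n \<Longrightarrow> quad B x \<le> \<alpha> * quad C x"
    and dg: "\<And>i. i < n \<Longrightarrow> C $$ (i, i) \<le> \<beta> * B $$ (i, i)"
  shows "eigval k (unit_diag n B) \<le> (\<alpha> * \<beta>) * eigval k (unit_diag n C)"
proof -
  let ?s = "\<lambda>i. sqrt (C $$ (i, i)) / sqrt (B $$ (i, i))"
  let ?S = "mat_diag n ?s"
  show ?thesis
  proof (rule eigval_comparison[OF unit_diag(1,2)[OF B] unit_diag(1,2)[OF C] mat_diag_dim _ k])
    show "0 \<le> \<alpha> * \<beta>" using ab by simp
    fix x :: "real vec" assume x: "x \<in> carrier_vec n"
    let ?y = "vec n (\<lambda>i. x $ i / sqrt (B $$ (i, i)))"
    have Sx: "?S *\<^sub>v x = vec n (\<lambda>i. ?s i * x $ i)" by (rule diag_mult_vec[OF x])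
    have qC: "quad (unit_diag n C) (?S *\<^sub>v x) = quad C ?y"
    proof -
      have "vec n (\<lambda>i. (?S *\<^sub>v x) $ i / sqrt (C $$ (i, i))) = ?y"
        unfolding Sx using spd_diag_pos[OF C] by (intro eq_vecI) (auto simp: less_imp_neq[symmetric])
      thus ?thesis using unit_diag(3)[OF C, of "?S *\<^sub>v x"] Sx by simp
    qed
    have "(?S *\<^sub>v x) \<bullet> (?S *\<^sub>v x) = (\<Sum>i<n. (C $$ (i, i) / B $$ (i, i)) * (x $ i)\<^sup>2)"
      unfolding Sx using spd_diag_pos[OF C] spd_diag_pos[OF B]
      by (subst scalar_prod_self_sum[of _ n])
        (auto intro!: sum.cong simp: power_mult_distrib power_divide less_imp_le)
    also have "\<dots> \<le> (\<Sum>i<n. \<beta> * (x $ i)\<^sup>2)"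
      using dg spd_diag_pos[OF B] by (intro sum_mono mult_right_mono) (auto simp: pos_divide_le_eq)
    also have "\<dots> = \<beta> * (x \<bullet> x)" by (simp add: scalar_prod_self_sum[OF x] sum_distrib_left)
    finally have 1: "(?S *\<^sub>v x) \<bullet> (?S *\<^sub>v x) \<le> \<beta> * (x \<bullet> x)" .
    have "quad (unit_diag n B) x * ((?S *\<^sub>v x) \<bullet> (?S *\<^sub>v x)) \<le> (\<alpha> * quad C ?y) * (\<beta> * (x \<bullet> x))"
      using le[of ?y] 1 spd_quad_nonneg[OF C, of ?y] ab real_scalar_prod_self_nonneg
      unfolding unit_diag(3)[OF B x] by (intro mult_mono) auto
    thus "quad (unit_diag n B) x * ((?S *\<^sub>v x) \<bullet> (?S *\<^sub>v x))
        \<le> (\<alpha> * \<beta>) * quad (unit_diag n C) (?S *\<^sub>v x) * (x \<bullet> x)"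
      unfolding qC by (simp add: mult_ac)
    assume "x \<noteq> 0\<^sub>v n"
    then obtain i where i: "i < n" "x $ i \<noteq> 0" using x by (metis carrier_vecD eq_vecI index_zero_vec)
    hence "(?S *\<^sub>v x) $ i \<noteq> 0" unfolding Sx using spd_diag_pos[OF C i(1)] spd_diag_pos[OF B i(1)] by simp
    thus "?S *\<^sub>v x \<noteq> 0\<^sub>v n" using i(1) by (metis index_zero_vec(1))
  qed
qed

text \<open>Both extreme eigenvalues of the scaled matrix change by a factor of at most \<open>(1 + t) / (1 - t)\<close>: one
part comes from the quadratic form, the other from the diagonal used for the scaling.\<close>

lemma scaled_cond2_perturbation:
  assumes B: "spd n B" and C: "spd n C" and n: "0 < n" and t: "0 \<le> t" "t < 1"
    and near: "\<And>x. x \<in> carrier_vec n \<Longrightarrow> \<bar>quad C x - quad B x\<bar> \<le> t * quad B x"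
  shows "scaled_cond2 C \<le> ((1 + t) / (1 - t))\<^sup>2 * scaled_cond2 B"
proof -
  define r where "r = (1 + t) / (1 - t)"
  have r: "0 < r" using t by (simp add: r_def)
  have hi: "quad C x \<le> (1 + t) * quad B x" and lo: "quad B x \<le> (1 / (1 - t)) * quad C x"
    if "x \<in> carrier_vec n" for x
    using near[OF that] t by (auto simp: abs_le_iff field_simps)
  have C': "C \<in> carrier_mat n n" and B': "B \<in> carrier_mat n n" using B C by (auto simp: spd_def)
  have dhi: "C $$ (i, i) \<le> (1 + t) * B $$ (i, i)"
    and dlo: "B $$ (i, i) \<le> (1 / (1 - t)) * C $$ (i, i)" if "i < n" for i
    using hi[of "unit_vec n i"] lo[of "unit_vec n i"]
    unfolding quad_unit_vec[OF B' that] quad_unit_vec[OF C' that] by simp_all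
  have "eigval 1 (unit_diag n C) \<le> ((1 + t) * (1 / (1 - t))) * eigval 1 (unit_diag n B)"
    using t n by (intro eigval_unit_diag_mono[OF C B _ _ _ hi dlo]) auto
  hence 1: "eigval 1 (unit_diag n C) \<le> r * eigval 1 (unit_diag n B)" by (simp add: r_def)
  have "eigval n (unit_diag n B) \<le> ((1 / (1 - t)) * (1 + t)) * eigval n (unit_diag n C)"
    using t n by (intro eigval_unit_diag_mono[OF B C _ _ _ lo dhi]) auto
  hence "eigval n (unit_diag n B) \<le> r * eigval n (unit_diag n C)" by (simp add: r_def)
  hence 2: "eigval n (unit_diag n B) / r \<le> eigval n (unit_diag n C)"
    using r by (simp add: pos_divide_le_eq mult.commute)
  have "scaled_cond2 C \<le> (r * eigval 1 (unit_diag n B)) / (eigval n (unit_diag n B) / r)"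
    unfolding scaled_cond2_unit_diag[OF C']
    using 1 2 r eigval_unit_diag_bounds[OF B n] by (intro frac_le) auto
  also have "\<dots> = r\<^sup>2 * scaled_cond2 B"
    unfolding scaled_cond2_unit_diag[OF B'] by (simp add: power2_eq_square)
  finally show ?thesis by (simp add: r_def)
qed


section \<open>Norm bounds\<close>

lemma spd_cauchy_schwarz:
  assumes B: "spd n B" and x: "x \<in> carrier_vec n" and y: "y \<in> carrier_vec n"
  shows "(y \<bullet> (B *\<^sub>v x))\<^sup>2 \<le> quad B y * quad B x"
proof (cases "x = 0\<^sub>v n")
  case True
  have "B *\<^sub>v 0\<^sub>v n = 0\<^sub>v n" using B unfolding spd_def by (intro eq_vecI) auto
  then show ?thesis using True y by simp
next
  case False
  have B': "B \<in> carrier_mat n n" "transpose_mat B = B" using B by (auto simp: spd_def)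
  have q: "0 < quad B x" using B x False by (simp add: spd_def)
  define c where "c = y \<bullet> (B *\<^sub>v x)"
  define t where "t = c / quad B x"
  have Bx: "B *\<^sub>v x \<in> carrier_vec n" "B *\<^sub>v y \<in> carrier_vec n" using B' x y by auto
  have "(B *\<^sub>v y) \<bullet> x = y \<bullet> (B *\<^sub>v x)"
    using transpose_vec_mult_scalar[OF B'(1) x y] B'(2) by simp
  hence xy: "x \<bullet> (B *\<^sub>v y) = c"
    using comm_scalar_prod[OF x Bx(2)] by (simp add: c_def)
  have "B *\<^sub>v (y - t \<cdot>\<^sub>v x) = B *\<^sub>v y - t \<cdot>\<^sub>v (B *\<^sub>v x)"
    using B' x y by (simp add: mult_minus_distrib_mat_vec[of _ n n] mult_mat_vec[of _ n n])
  hence "quad B (y - t \<cdot>\<^sub>v x) = quad B y - 2 * t * c + t\<^sup>2 * quad B x"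
    using x y Bx xy
    by (simp add: minus_scalar_prod_distrib[of _ n] scalar_prod_minus_distrib[of _ n] c_def
        power2_eq_square algebra_simps)
  also have "\<dots> = quad B y - c\<^sup>2 / quad B x"
    using q by (simp add: t_def power2_eq_square)
  finally have "c\<^sup>2 / quad B x \<le> quad B y"
    using spd_quad_nonneg[OF B, of "y - t \<cdot>\<^sub>v x"] x y by simp
  thus ?thesis using q by (simp add: c_def pos_divide_le_eq)
qed

lemma spd_entry_bound:
  assumes B: "spd n B" and ij: "i < n" "j < n"
  shows "\<bar>B $$ (i, j)\<bar> \<le> sqrt (B $$ (i, i) * B $$ (j, j))"
proof -
  have B': "B \<in> carrier_mat n n" using B by (simp add: spd_def)
  have "unit_vec n i \<bullet> (B *\<^sub>v unit_vec n j) = B $$ (i, j)" using B' ij by simp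
  hence "(B $$ (i, j))\<^sup>2 \<le> B $$ (i, i) * B $$ (j, j)"
    using spd_cauchy_schwarz[OF B, of "unit_vec n j" "unit_vec n i"]
    unfolding quad_unit_vec[OF B' ij(1)] quad_unit_vec[OF B' ij(2)] by simp
  thus ?thesis using real_sqrt_le_mono by fastforce
qed

text \<open>The Cauchy-Schwarz inequality of the form \<open>B\<close>, applied to \<open>x\<close> and \<open>B x\<close>, bounds \<open>\<parallel>B x\<parallel>\<^sup>4\<close> by
\<open>\<lambda>\<^sub>1(B)\<^sup>2 \<parallel>B x\<parallel>\<^sup>2 \<parallel>x\<parallel>\<^sup>2\<close>.\<close>

lemma spd_mult_vec_bound:
  assumes B: "spd n B" and x: "x \<in> carrier_vec n" and n: "0 < n"
  shows "(B *\<^sub>v x) \<bullet> (B *\<^sub>v x) \<le> (eigval 1 B)\<^sup>2 * (x \<bullet> x)"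
proof -
  have B': "B \<in> carrier_mat n n" "transpose_mat B = B" using B by (auto simp: spd_def)
  define y where "y = B *\<^sub>v x"
  have y: "y \<in> carrier_vec n" using B' x by (simp add: y_def)
  have l: "0 < eigval 1 B" using spd_eigval_pos[OF B, of 1] n by simp
  have "(y \<bullet> y) * (y \<bullet> y) \<le> quad B y * quad B x"
    using spd_cauchy_schwarz[OF B x y] by (simp add: y_def power2_eq_square)
  also have "\<dots> \<le> (eigval 1 B * (y \<bullet> y)) * (eigval 1 B * (x \<bullet> x))"
    using rayleigh_bounds(2)[OF B' x] rayleigh_bounds(2)[OF B' y] spd_quad_nonneg[OF B x] l
      real_scalar_prod_self_nonneg[of y] by (intro mult_mono) auto
  finally have "(y \<bullet> y) * (y \<bullet> y) \<le> ((eigval 1 B)\<^sup>2 * (x \<bullet> x)) * (y \<bullet> y)"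
    by (simp add: power2_eq_square mult_ac)
  hence "y \<bullet> y \<le> (eigval 1 B)\<^sup>2 * (x \<bullet> x) \<or> y \<bullet> y = 0"
    using real_scalar_prod_self_nonneg[of y]
    by (cases "y \<bullet> y = 0") (auto simp: mult_le_cancel_right)
  thus ?thesis using real_scalar_prod_self_nonneg[of x] by (auto simp: y_def)
qed

text \<open>By the Cauchy-Schwarz inequality over the pairs \<open>(l, k)\<close> the sum is at most the Frobenius norm of \<open>A\<close>
times the product of the norms of the columns \<open>i\<close> and \<open>j\<close> of \<open>Q\<close>. The factor \<open>\<surd>n\<close> is the price for
bounding the Frobenius norm by the spectral norm.\<close>

lemma abs_congruence_bound:
  assumes A: "spd n A" and Q: "Q \<in> carrier_mat n n" and n: "0 < n" and ij: "i < n" "j < n"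
    and qi: "col Q i \<bullet> col Q i \<le> r" and qj: "col Q j \<bullet> col Q j \<le> r"
  shows "(\<Sum>l<n. \<Sum>k<n. \<bar>A $$ (k, l)\<bar> * \<bar>Q $$ (k, i) * Q $$ (l, j)\<bar>)
    \<le> sqrt (real n) * eigval 1 A * r"
proof -
  have A': "A \<in> carrier_mat n n" using A by (simp add: spd_def)
  have l: "0 < eigval 1 A" using spd_eigval_pos[OF A, of 1] n by simp
  have r: "0 \<le> r" using qi real_scalar_prod_self_nonneg order_trans by blast
  let ?I = "{..<n} \<times> {..<n}"
  let ?f = "\<lambda>(l, k). A $$ (k, l)" and ?g = "\<lambda>(l, k). Q $$ (k, i) * Q $$ (l, j)"
  have colQ: "col Q i \<bullet> col Q i = (\<Sum>k<n. (Q $$ (k, i))\<^sup>2)" if "i < n" for i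
    using Q that by (subst scalar_prod_self_sum[of _ n]) auto
  have "(\<Sum>l<n. \<Sum>k<n. (A $$ (k, l))\<^sup>2) \<le> (\<Sum>l<n. (eigval 1 A)\<^sup>2)"
  proof (rule sum_mono)
    fix l assume "l \<in> {..<n}"
    hence l: "l < n" by simp
    have "col A l \<bullet> col A l = (\<Sum>k<n. (A $$ (k, l))\<^sup>2)"
      using A' l by (subst scalar_prod_self_sum[of _ n]) auto
    moreover have "A *\<^sub>v unit_vec n l = col A l" using A' l by (intro eq_vecI) auto
    ultimately show "(\<Sum>k<n. (A $$ (k, l))\<^sup>2) \<le> (eigval 1 A)\<^sup>2"
      using spd_mult_vec_bound[OF A _ n, of "unit_vec n l"] l by simp
  qed
  also have "\<dots> = real n * (eigval 1 A)\<^sup>2" by simp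
  finally have "L2_set ?f ?I \<le> sqrt (real n * (eigval 1 A)\<^sup>2)"
    unfolding L2_set_def by (simp add: sum.cartesian_product case_prod_unfold)
  hence f: "L2_set ?f ?I \<le> sqrt (real n) * eigval 1 A" using l by (simp add: real_sqrt_mult)
  have "(\<Sum>l<n. \<Sum>k<n. (Q $$ (k, i) * Q $$ (l, j))\<^sup>2)
      = (\<Sum>k<n. (Q $$ (k, i))\<^sup>2) * (\<Sum>l<n. (Q $$ (l, j))\<^sup>2)"
    by (simp add: sum_product power_mult_distrib) (rule sum.swap)
  also have "\<dots> \<le> r * r"
    unfolding colQ[OF ij(1), symmetric] colQ[OF ij(2), symmetric]
    using qi qj r real_scalar_prod_self_nonneg by (intro mult_mono) auto
  finally have "L2_set ?g ?I \<le> sqrt (r * r)"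
    unfolding L2_set_def
    by (intro real_sqrt_le_mono) (simp add: sum.cartesian_product case_prod_unfold)
  hence g: "L2_set ?g ?I \<le> r" using r by simp
  have "(\<Sum>l<n. \<Sum>k<n. \<bar>A $$ (k, l)\<bar> * \<bar>Q $$ (k, i) * Q $$ (l, j)\<bar>)
      = (\<Sum>p\<in>?I. \<bar>?f p\<bar> * \<bar>?g p\<bar>)"
    by (simp add: sum.cartesian_product case_prod_unfold)
  also have "\<dots> \<le> L2_set ?f ?I * L2_set ?g ?I" by (rule L2_set_mult_ineq)
  also have "\<dots> \<le> (sqrt (real n) * eigval 1 A) * r"
    using f g l by (intro mult_mono) (auto intro: L2_set_nonneg)
  finally show ?thesis .
qed

lemma vec_norm2_L2_set:
  "x \<in> carrier_vec n \<Longrightarrow> vec_norm2 x = L2_set (($) x) {..<n}"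
  by (simp add: vec_norm2_def L2_set_def scalar_prod_self_sum)

lemma scalar_prod_le_vec_norm2:
  assumes "x \<in> carrier_vec n" "y \<in> carrier_vec n"
  shows "\<bar>x \<bullet> y\<bar> \<le> vec_norm2 x * vec_norm2 y"
proof -
  have "\<bar>x \<bullet> y\<bar> \<le> (\<Sum>i<n. \<bar>x $ i\<bar> * \<bar>y $ i\<bar>)"
    unfolding scalar_prod_sum[OF assms(2)] by (rule order_trans[OF sum_abs]) (simp add: abs_mult)
  also have "\<dots> \<le> vec_norm2 x * vec_norm2 y"
    unfolding vec_norm2_L2_set[OF assms(1)] vec_norm2_L2_set[OF assms(2)] by (rule L2_set_mult_ineq)
  finally show ?thesis .
qed

text \<open>Only the boundedness of the set in the definition of \<open>mat_norm2\<close> needs a proof; the norms of the rows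
bound the entries of \<open>M x\<close>.\<close>

lemma vec_norm2_le_mat_norm2:
  assumes M: "M \<in> carrier_mat n n" and x: "x \<in> carrier_vec n" "vec_norm2 x = 1"
  shows "vec_norm2 (M *\<^sub>v x) \<le> mat_norm2 M"
proof -
  have "vec_norm2 (M *\<^sub>v y) \<le> (\<Sum>i<n. vec_norm2 (row M i))"
    if y: "y \<in> carrier_vec n" "vec_norm2 y = 1" for y
  proof -
    have "M *\<^sub>v y \<in> carrier_vec n" using M y by simp
    hence "vec_norm2 (M *\<^sub>v y) \<le> (\<Sum>i<n. \<bar>(M *\<^sub>v y) $ i\<bar>)"
      unfolding vec_norm2_L2_set[OF \<open>M *\<^sub>v y \<in> carrier_vec n\<close>] by (intro L2_set_le_sum_abs)
    also have "\<dots> \<le> (\<Sum>i<n. vec_norm2 (row M i))"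
    proof (rule sum_mono)
      fix i assume "i \<in> {..<n}"
      thus "\<bar>(M *\<^sub>v y) $ i\<bar> \<le> vec_norm2 (row M i)"
        using scalar_prod_le_vec_norm2[of "row M i" n y] M y by simp
    qed
    finally show ?thesis .
  qed
  hence "bdd_above ((\<lambda>x. vec_norm2 (M *\<^sub>v x)) ` {x \<in> carrier_vec (dim_col M). vec_norm2 x = 1})"
    using M by (intro bdd_aboveI2) auto
  thus ?thesis unfolding mat_norm2_def using x M by (intro cSUP_upper) auto
qed

lemma quad_le_mat_norm2:
  assumes M: "M \<in> carrier_mat n n" and x: "x \<in> carrier_vec n"
  shows "\<bar>quad M x\<bar> \<le> mat_norm2 M * (x \<bullet> x)"
proof (cases "x = 0\<^sub>v n")
  case True
  have "M *\<^sub>v 0\<^sub>v n = 0\<^sub>v n" using M by (intro eq_vecI) auto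
  thus ?thesis using True by simp
next
  case False
  define r where "r = vec_norm2 x"
  have r2: "x \<bullet> x = r\<^sup>2" and r: "0 < r"
    using real_scalar_prod_self_pos[OF x False] by (simp_all add: r_def vec_norm2_def)
  define y where "y = (1 / r) \<cdot>\<^sub>v x"
  have y: "y \<in> carrier_vec n" "x = r \<cdot>\<^sub>v y" using x r by (auto simp: y_def smult_smult_assoc)
  have "y \<bullet> y = 1" using x r r2 by (simp add: y_def power2_eq_square)
  hence y1: "vec_norm2 y = 1" by (simp add: vec_norm2_def)
  have My: "M *\<^sub>v y \<in> carrier_vec n" using M y by simp
  have "\<bar>quad M y\<bar> \<le> vec_norm2 y * vec_norm2 (M *\<^sub>v y)" by (rule scalar_prod_le_vec_norm2[OF y(1) My])
  also have "\<dots> \<le> mat_norm2 M" using vec_norm2_le_mat_norm2[OF M y(1) y1] y1 by simp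
  finally have *: "\<bar>quad M y\<bar> \<le> mat_norm2 M" .
  have "quad M x = r\<^sup>2 * quad M y"
    unfolding y(2) using M y(1) My by (simp add: mult_mat_vec[of _ n n] power2_eq_square)
  hence "\<bar>quad M x\<bar> = r\<^sup>2 * \<bar>quad M y\<bar>" by (simp add: abs_mult)
  also have "\<dots> \<le> r\<^sup>2 * mat_norm2 M" using * by (intro mult_left_mono) auto
  finally show ?thesis by (simp add: r2 mult.commute)
qed

lemma near_isometry:
  assumes Q: "Q \<in> carrier_mat n n" and h: "mat_norm2 (transpose_mat Q * Q - 1\<^sub>m n) \<le> h"
    and x: "x \<in> carrier_vec n"
  shows "\<bar>(Q *\<^sub>v x) \<bullet> (Q *\<^sub>v x) - x \<bullet> x\<bar> \<le> h * (x \<bullet> x)"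
proof -
  let ?M = "transpose_mat Q * Q - 1\<^sub>m n"
  have QQ: "transpose_mat Q * Q \<in> carrier_mat n n" using Q by simp
  have M: "?M \<in> carrier_mat n n" by (intro minus_carrier_mat) auto
  have "?M *\<^sub>v x = (transpose_mat Q * Q) *\<^sub>v x - x"
    using QQ x by (simp add: minus_mult_distrib_mat_vec[of _ n n] del: assoc_mult_mat_vec)
  moreover have "quad (transpose_mat Q * Q) x = (Q *\<^sub>v x) \<bullet> (Q *\<^sub>v x)"
    using quad_congruence[OF one_carrier_mat Q x] Q x by simp
  ultimately have "quad ?M x = (Q *\<^sub>v x) \<bullet> (Q *\<^sub>v x) - x \<bullet> x"
    using x mult_mat_vec_carrier[OF QQ x] by (simp add: scalar_prod_minus_distrib[of _ n] del: assoc_mult_mat_vec)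
  moreover have "mat_norm2 ?M * (x \<bullet> x) \<le> h * (x \<bullet> x)"
    by (rule mult_right_mono[OF h real_scalar_prod_self_nonneg])
  ultimately show ?thesis using quad_le_mat_norm2[OF M x] by simp
qed

section \<open>Perturbation of the preconditioned matrix\<close>

text \<open>In the scaled variable \<open>z\<^sub>i = \<surd>B\<^sub>i\<^sub>i x\<^sub>i\<close> the change of the quadratic form is at most
\<open>e (\<Sum>i. \<bar>z\<^sub>i\<bar>)\<^sup>2 \<le> e n \<parallel>z\<parallel>\<^sup>2\<close>, while \<open>quad B x\<close> is at least \<open>\<parallel>z\<parallel>\<^sup>2\<close> times the smallest eigenvalue of the
scaled matrix.\<close>

lemma scaled_entrywise_perturbation:
  assumes B: "spd n B" and C: "C \<in> carrier_mat n n" and n: "0 < n" and e: "0 \<le> e"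
    and near: "\<And>i j. i < n \<Longrightarrow> j < n \<Longrightarrow>
      \<bar>C $$ (i, j) - B $$ (i, j)\<bar> \<le> e * sqrt (B $$ (i, i) * B $$ (j, j))"
    and x: "x \<in> carrier_vec n"
  shows "\<bar>quad C x - quad B x\<bar> \<le> e * real n * scaled_cond2 B * quad B x"
proof -
  have B': "B \<in> carrier_mat n n" using B by (simp add: spd_def)
  define s where "s i = sqrt (B $$ (i, i))" for i
  have s: "0 < s i" if "i < n" for i using spd_diag_pos[OF B that] by (simp add: s_def)
  define z where "z = vec n (\<lambda>i. s i * x $ i)"
  have z: "z \<in> carrier_vec n" by (simp add: z_def)
  have "s i \<noteq> 0" if "i < n" for i using s[OF that] by simp
  hence "vec n (\<lambda>i. z $ i / s i) = x"
    using x by (intro eq_vecI) (auto simp: z_def)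
  hence "quad (unit_diag n B) z = quad B x" using unit_diag(3)[OF B z] by (simp add: s_def)
  hence "eigval n (unit_diag n B) * (z \<bullet> z) \<le> quad B x"
    using rayleigh_bounds(1)[OF unit_diag(1,2)[OF B] z] by simp
  hence "z \<bullet> z \<le> (1 / eigval n (unit_diag n B)) * quad B x"
    using eigval_unit_diag_bounds(1)[OF B n] by (simp add: field_simps)
  also have "\<dots> \<le> scaled_cond2 B * quad B x"
    by (rule mult_right_mono[OF eigval_unit_diag_bounds(5)[OF B n] spd_quad_nonneg[OF B x]])
  finally have zz: "z \<bullet> z \<le> scaled_cond2 B * quad B x" .
  have "quad C x - quad B x
      = (\<Sum>i<n. \<Sum>j<n. x $ i * (C $$ (i, j) - B $$ (i, j)) * x $ j)"
    unfolding quad_sum[OF C x] quad_sum[OF B' x] sum_subtractf[symmetric] by (simp add: algebra_simps)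
  also have "\<bar>\<dots>\<bar> \<le> (\<Sum>i<n. \<Sum>j<n. \<bar>x $ i * (C $$ (i, j) - B $$ (i, j)) * x $ j\<bar>)"
    by (rule order_trans[OF sum_abs]) (intro sum_mono sum_abs)
  also have "\<dots> \<le> (\<Sum>i<n. \<Sum>j<n. e * (\<bar>z $ i\<bar> * \<bar>z $ j\<bar>))"
  proof (intro sum_mono)
    fix i j assume "i \<in> {..<n}" "j \<in> {..<n}"
    hence ij: "i < n" "j < n" by auto
    have "\<bar>x $ i * (C $$ (i, j) - B $$ (i, j)) * x $ j\<bar>
        = \<bar>C $$ (i, j) - B $$ (i, j)\<bar> * (\<bar>x $ i\<bar> * \<bar>x $ j\<bar>)" by (simp add: abs_mult mult_ac)
    also have "\<dots> \<le> (e * (s i * s j)) * (\<bar>x $ i\<bar> * \<bar>x $ j\<bar>)"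
      using near[OF ij] by (intro mult_right_mono) (auto simp: s_def real_sqrt_mult)
    also have "\<dots> = e * (\<bar>z $ i\<bar> * \<bar>z $ j\<bar>)"
      using ij s[OF ij(1)] s[OF ij(2)] by (simp add: z_def abs_mult mult_ac)
    finally show "\<bar>x $ i * (C $$ (i, j) - B $$ (i, j)) * x $ j\<bar> \<le> e * (\<bar>z $ i\<bar> * \<bar>z $ j\<bar>)" .
  qed
  also have "\<dots> = e * (\<Sum>i<n. \<Sum>j<n. \<bar>z $ i\<bar> * \<bar>z $ j\<bar>)"
    by (simp only: sum_distrib_left)
  also have "(\<Sum>i<n. \<Sum>j<n. \<bar>z $ i\<bar> * \<bar>z $ j\<bar>) = (\<Sum>i<n. \<bar>z $ i\<bar> * \<bar>1\<bar>)\<^sup>2"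
    by (simp only: power2_eq_square sum_product abs_one mult_1_right)
  also have "(\<Sum>i<n. \<bar>z $ i\<bar> * \<bar>1\<bar>)\<^sup>2 \<le> (L2_set (($) z) {..<n} * L2_set (\<lambda>_. 1) {..<n})\<^sup>2"
    by (intro power_mono L2_set_mult_ineq sum_nonneg) auto
  also have "\<dots> = real n * (z \<bullet> z)"
    by (simp add: L2_set_def power_mult_distrib scalar_prod_self_sum[OF z] sum_nonneg)
  finally have "\<bar>quad C x - quad B x\<bar> \<le> e * (real n * (z \<bullet> z))"
    using e by (simp add: mult_left_mono)
  also have "\<dots> \<le> e * (real n * (scaled_cond2 B * quad B x))"
    using zz e by (intro mult_left_mono) auto
  finally show ?thesis by (simp add: mult_ac)
qed

text \<open>By \<open>fl_congruence_error\<close> and \<open>abs_congruence_bound\<close> the two products have an error of at most \<open>(2 g + g\<^sup>2) \<surd>n \<lambda>\<^sub>1(A) (1 + h)\<close>, and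
the bound on \<open>g\<close> makes \<open>g \<surd>n \<lambda>\<^sub>1(A)\<close> at most \<open>(u / 16) (1 - h) \<lambda>\<^sub>n(A)\<close>, where \<open>(1 - h) \<lambda>\<^sub>n(A)\<close> is a
lower bound for the diagonal of \<open>T\<close>. With \<open>g \<le> 1/10\<close> and \<open>h \<le> 1\<close> this is less than \<open>3/10 u\<close>
in units of \<open>\<surd>(T\<^sub>i\<^sub>i T\<^sub>j\<^sub>j)\<close>. Since \<open>\<bar>T\<^sub>i\<^sub>j\<bar> \<le> \<surd>(T\<^sub>i\<^sub>i T\<^sub>j\<^sub>j)\<close> for a positive definite matrix, the
demotion contributes at most \<open>11/10 u\<close> in the same units.\<close>

lemma computed_precond_entry_error:
  assumes A: "spd n A" and Q: "Q \<in> carrier_mat n n" and n: "0 < n"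
    and C: "computed_precond u uh A Q C"
    and uh: "0 < uh" "uh < u" "u < 1 / 10" "real n * uh < 1"
    and h: "h < 1" and near: "\<And>x. x \<in> carrier_vec n \<Longrightarrow>
      \<bar>(Q *\<^sub>v x) \<bullet> (Q *\<^sub>v x) - x \<bullet> x\<bar> \<le> h * (x \<bullet> x)"
    and g: "g = real n * uh / (1 - real n * uh)" "g < u * (1 - h) / (16 * sqrt (real n) * cond2 A)"
    and T: "T = transpose_mat Q * A * Q"
  shows "C \<in> carrier_mat n n" "transpose_mat C = C"
    and "i < n \<Longrightarrow> j < n \<Longrightarrow> \<bar>C $$ (i, j) - T $$ (i, j)\<bar> \<le> 7 / 5 * u * sqrt (T $$ (i, i) * T $$ (j, j))"
proof -
  have A': "A \<in> carrier_mat n n" "transpose_mat A = A" using A by (auto simp: spd_def)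
  obtain Y H where Y: "fl_mat_mult uh (transpose_mat Q) A Y" and H: "fl_mat_mult uh Y Q H"
    and Cc: "C \<in> carrier_mat (dim_row H) (dim_col H)" and Csym: "transpose_mat C = C"
    and CH: "\<And>i j. i < dim_row H \<Longrightarrow> j < dim_col H \<Longrightarrow>
      rounds_to u (H $$ (i, j)) (C $$ (i, j)) \<or> rounds_to u (H $$ (j, i)) (C $$ (i, j))"
    using C unfolding computed_precond_def by blast
  have Hc: "H \<in> carrier_mat n n" using Y H A' Q unfolding fl_mat_mult_def by auto
  show "C \<in> carrier_mat n n" "transpose_mat C = C" using Cc Hc Csym by auto
  have T_spd: "spd n T" unfolding T by (rule ostrowski(1)[OF A Q h near])
  have Tsym: "T $$ (i, j) = T $$ (j, i)" if "i < n" "j < n" for i j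
    using T_spd that unfolding spd_def by (metis carrier_matD index_transpose_mat(1))
  define l1 where "l1 = eigval 1 A"
  define ln where "ln = eigval n A"
  have ln: "0 < ln" and l1: "0 < l1" using spd_eigval_pos[OF A] n by (auto simp: ln_def l1_def)
  have "ln \<le> l1"
    using rayleigh_bounds[OF A', of "unit_vec n 0"] n by (simp add: ln_def l1_def)
  have k: "cond2 A = l1 / ln" unfolding cond2_def l1_def ln_def using A' by simp
  have h0: "0 \<le> h" using near[of "unit_vec n 0"] n by simp
  have g0: "0 \<le> g" unfolding g(1) using uh by simp
  define w where "w = sqrt (real n)"
  have w1: "1 \<le> w" using n by (simp add: w_def)
  have "0 < 16 * w * (l1 / ln)" using w1 l1 ln by simp
  hence "g * (16 * w * (l1 / ln)) < u * (1 - h)"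
    using g(2) unfolding k w_def[symmetric] by (simp only: pos_less_divide_eq)
  hence gk: "16 * (g * w * l1) \<le> u * (1 - h) * ln" using ln by (simp add: field_simps)
  have gs: "g \<le> 1 / 10"
  proof -
    have "g * ln \<le> g * w * l1" using g0 w1 \<open>ln \<le> l1\<close> ln
      by (metis mult.assoc mult_left_mono mult_mono' less_imp_le mult_1 zero_le_one)
    hence "16 * (g * ln) \<le> u * (1 - h) * ln" using gk by simp
    hence "16 * g \<le> u * (1 - h)" using ln by (simp add: mult.assoc[symmetric])
    also have "\<dots> \<le> u * 1" using uh h0 by (intro mult_left_mono) auto
    finally show ?thesis using uh by simp
  qed
  have col: "Q *\<^sub>v unit_vec n i = col Q i" if "i < n" for i
    using Q that by (intro eq_vecI) auto
  have qhi: "col Q i \<bullet> col Q i \<le> 1 + h" and qlo: "1 - h \<le> col Q i \<bullet> col Q i" if "i < n" for i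
    using near[of "unit_vec n i"] that unfolding col[OF that] by (auto simp: abs_le_iff)
  have Tii: "(1 - h) * ln \<le> T $$ (i, i)" if i: "i < n" for i
  proof -
    have "(1 - h) * ln \<le> ln * (col Q i \<bullet> col Q i)"
      using qlo[OF i] ln by (simp add: mult.commute)
    also have "\<dots> \<le> quad A (col Q i)"
      unfolding ln_def using Q i by (intro rayleigh_bounds(1)[OF A']) auto
    also have "\<dots> = T $$ (i, i)" unfolding T by (rule congruence_index[OF A'(1) Q i i, symmetric])
    finally show ?thesis .
  qed
  have HT: "\<bar>H $$ (i, j) - T $$ (i, j)\<bar> \<le> 3 / 10 * u * sqrt (T $$ (i, i) * T $$ (j, j))"
    if ij: "i < n" "j < n" for i j
  proof -
    define t where "t = sqrt (T $$ (i, i) * T $$ (j, j))"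
    have "sqrt (((1 - h) * ln) * ((1 - h) * ln)) \<le> t"
      unfolding t_def using Tii[OF ij(1)] Tii[OF ij(2)] ln h
      by (intro real_sqrt_le_mono mult_mono) (auto intro: order_trans[rotated])
    hence t: "(1 - h) * ln \<le> t" using ln h by simp
    have "\<bar>H $$ (i, j) - T $$ (i, j)\<bar> \<le> (2 * g + g\<^sup>2) *
        (\<Sum>l<n. \<Sum>k<n. \<bar>A $$ (k, l)\<bar> * \<bar>Q $$ (k, i) * Q $$ (l, j)\<bar>)"
      unfolding T using uh by (intro fl_congruence_error[OF A'(1) Q Y H _ _ g(1) ij]) auto
    also have "\<dots> \<le> (2 * g + g\<^sup>2) * (w * l1 * (1 + h))"
      unfolding w_def l1_def using g0 qhi ij
      by (intro mult_left_mono abs_congruence_bound[OF A Q n ij]) auto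
    also have "\<dots> = ((2 + g) * (1 + h)) * (g * w * l1)" by (simp add: power2_eq_square algebra_simps)
    also have "\<dots> \<le> (21 / 10 * 2) * (u * ((1 - h) * ln) / 16)"
      using gk gs g0 h h0 l1 w1 by (intro mult_mono) auto
    also have "\<dots> \<le> (21 / 10 * 2) * (u * t / 16)"
      using t uh by (intro mult_left_mono divide_right_mono) auto
    also have "\<dots> \<le> 3 / 10 * u * t"
    proof -
      have "0 \<le> t" using t ln h by (smt (verit) mult_nonneg_nonneg)
      hence "0 \<le> u * t" using uh by simp
      thus ?thesis by (simp add: mult.commute)
    qed
    finally show ?thesis unfolding t_def .
  qed
  assume ij: "i < n" "j < n"
  define t where "t = sqrt (T $$ (i, i) * T $$ (j, j))"
  \<comment> \<open>\<open>y\<close> is the entry of the product, \<open>(i, j)\<close> or \<open>(j, i)\<close>, that was kept; the bound is symmetric in \<open>i\<close> and \<open>j\<close>\<close>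
  obtain y where y: "rounds_to u y (C $$ (i, j))" "\<bar>y - T $$ (i, j)\<bar> \<le> 3 / 10 * u * t"
    using CH[of i j] Hc ij HT[OF ij] HT[OF ij(2,1)] Tsym[OF ij]
    unfolding t_def by (metis carrier_matD mult.commute)
  obtain d where d: "\<bar>d\<bar> \<le> u" "C $$ (i, j) = y * (1 + d)" using y(1) unfolding rounds_to_def by blast
  have Tt: "\<bar>T $$ (i, j)\<bar> \<le> t" unfolding t_def by (rule spd_entry_bound[OF T_spd ij])
  have "\<bar>y\<bar> \<le> 3 / 10 * u * t + t" using y(2) Tt by linarith
  also have "\<dots> \<le> 11 / 10 * t"
  proof -
    have "u * t \<le> 1 / 10 * t" using uh Tt by (intro mult_right_mono) auto
    thus ?thesis using Tt by linarith
  qed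
  finally have "\<bar>y * d\<bar> \<le> (11 / 10 * t) * u" unfolding abs_mult using d(1) Tt by (intro mult_mono) auto
  moreover have "C $$ (i, j) - T $$ (i, j) = (y - T $$ (i, j)) + y * d"
    using d(2) by (simp add: algebra_simps)
  ultimately have "\<bar>C $$ (i, j) - T $$ (i, j)\<bar> \<le> 3 / 10 * u * t + 11 / 10 * t * u"
    using y(2) by linarith
  also have "\<dots> = 7 / 5 * u * t" by (simp add: algebra_simps)
  finally show "\<bar>C $$ (i, j) - T $$ (i, j)\<bar> \<le> 7 / 5 * u * sqrt (T $$ (i, i) * T $$ (j, j))"
    unfolding t_def .
qed

section \<open>Forward error of the computed eigenvalues\<close>

lemma abs_poly_le:
  fixes x :: real
  assumes "0 \<le> x"
  shows "\<bar>poly p x\<bar> \<le> poly (map_poly abs p) x"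
proof (induction p)
  case (pCons a p)
  have "\<bar>poly (pCons a p) x\<bar> \<le> \<bar>a\<bar> + x * \<bar>poly p x\<bar>"
    using assms by (simp add: abs_mult order_trans[OF abs_triangle_ineq])
  also have "\<dots> \<le> \<bar>a\<bar> + x * poly (map_poly abs p) x"
    using pCons.IH assms by (simp add: mult_left_mono)
  also have "\<dots> = poly (pCons \<bar>a\<bar> (map_poly abs p)) x" by simp
  also have "pCons \<bar>a\<bar> (map_poly abs p) = map_poly abs (pCons a p)"
    by (intro poly_eqI) (simp add: coeff_map_poly coeff_pCons split: nat.splits)
  finally show ?case .
qed simp

text \<open>The three errors are relative to \<open>lC\<close>, \<open>lT\<close> and \<open>lA\<close>. Here \<open>lT \<le> 2 lA\<close> and \<open>lC \<le> 11/10 lT\<close>, so that in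
units of \<open>lA\<close> they are at most \<open>3/2 \<cdot> 11/5 a \<le> 4 a\<close>, \<open>2 t\<close> and \<open>h\<close>.\<close>

lemma relative_error_accumulation:
  fixes lA lT lC :: real
  assumes lA: "0 < lA" and h: "0 \<le> h" "h < 1" and t: "0 \<le> t" "t \<le> 1 / 10" and a: "0 \<le> a"
    and 1: "\<bar>lT - lA\<bar> \<le> h * lA" and 2: "\<bar>lC - lT\<bar> \<le> t * lT"
    and 3: "\<bar>m - lC\<bar> \<le> c * lC" and c: "c \<le> 3 / 2 * a"
  shows "\<bar>m - lA\<bar> / lA \<le> 4 * a + 2 * t + h"
proof -
  have "h * lA < lA" using lA h by simp
  hence T: "0 < lT" "lT \<le> 2 * lA" using 1 by linarith+
  have tT: "t * lT \<le> 1 / 10 * lT" using t T by (intro mult_right_mono) auto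
  hence C: "0 < lC" "lC \<le> 11 / 5 * lA" using 2 T by linarith+
  have "\<bar>m - lC\<bar> \<le> 3 / 2 * a * lC" using 3 mult_right_mono[OF c less_imp_le[OF C(1)]] by linarith
  also have "\<dots> \<le> 3 / 2 * a * (11 / 5 * lA)" using C(2) a by (intro mult_left_mono) auto
  also have "\<dots> \<le> 4 * a * lA" using a lA by simp
  finally have "\<bar>m - lC\<bar> \<le> 4 * a * lA" .
  moreover have "\<bar>lC - lT\<bar> \<le> 2 * t * lA"
    using 2 mult_left_mono[OF T(2) t(1)] by linarith
  ultimately have "\<bar>m - lA\<bar> \<le> (4 * a + 2 * t + h) * lA"
    using 1 by (simp add: algebra_simps)
  thus ?thesis using lA by (simp add: pos_divide_le_eq)
qed

text \<open>The number \<open>P\<close> replaces the value of \<open>p\<^sub>J\<close>, which may be negative. The smallness of the right-hand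
side is what puts \<open>C\<close> into the range of validity of the Jacobi accuracy bound.\<close>

lemma preconditioned_forward_error:
  assumes u: "0 < uh" "uh < u" "u < 1 / 10" "real n * uh < 1"
    and jac: "accurate_jacobi pJ u tol jac"
    and A: "spd n A" and Q: "Q \<in> carrier_mat n n"
    and h: "mat_norm2 (transpose_mat Q * Q - 1\<^sub>m n) \<le> h" "h < 1"
    and C: "computed_precond u uh A Q C"
    and g: "real n * uh / (1 - real n * uh) < u * (1 - h) / (16 * sqrt (real n) * cond2 A)"
    and T: "T = transpose_mat Q * A * Q"
    and A3: "14 * real n * u * scaled_cond2 T < 1"
    and P: "\<bar>poly pJ (real n)\<bar> \<le> P" and small: "(4 * P + 3 * real n) * scaled_cond2 T * u < 1"
    and k: "k \<in> {1..n}"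
  shows "\<bar>kth_largest k (jac C) - eigval k A\<bar> / eigval k A
    \<le> (4 * P + 3 * real n) * scaled_cond2 T * u + h"
proof -
  have n: "0 < n" using k by auto
  note near = near_isometry[OF Q h(1)]
  have T_spd: "spd n T" unfolding T by (rule ostrowski(1)[OF A Q h(2) near])
  have T': "T \<in> carrier_mat n n" "transpose_mat T = T" using T_spd by (auto simp: spd_def)
  have h0: "0 \<le> h" using near[of "unit_vec n 0"] n by simp
  define K where "K = scaled_cond2 T"
  have K: "1 \<le> K" unfolding K_def by (rule eigval_unit_diag_bounds(4)[OF T_spd n])
  define t where "t = 7 / 5 * u * real n * K"
  have "t = (14 * real n * u * scaled_cond2 T) / 10" by (simp add: t_def K_def)
  hence "t \<le> 1 / 10" using A3 by linarith
  moreover have "0 \<le> t" using u K by (simp add: t_def)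
  ultimately have t: "0 \<le> t" "t \<le> 1 / 10" by auto
  note C' = computed_precond_entry_error[OF A Q n C u h(2) near refl g T]
  have CT: "\<bar>quad C x - quad T x\<bar> \<le> t * quad T x" if "x \<in> carrier_vec n" for x
    unfolding t_def K_def
    using scaled_entrywise_perturbation[OF T_spd C'(1) n _ C'(3) that] u by simp
  have Chi: "quad C x \<le> (1 + t) * quad T x" and Clo: "quad T x \<le> 1 / (1 - t) * quad C x"
    if "x \<in> carrier_vec n" for x
    using CT[OF that] t by (auto simp: abs_le_iff field_simps)
  have C_spd: "spd n C"
    unfolding spd_def
  proof (intro conjI ballI impI C'(1,2))
    fix x :: "real vec" assume x: "x \<in> carrier_vec n" "x \<noteq> 0\<^sub>v n"
    have q: "0 < quad T x" using T_spd x unfolding spd_def by blast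
    have "t * quad T x \<le> 1 / 10 * quad T x" using q t by (intro mult_right_mono) auto
    thus "0 < quad C x" using CT[OF x(1)] q by linarith
  qed
  \<comment> \<open>\<open>(1 + t) / (1 - t) \<le> 11/9\<close> for \<open>t \<le> 1/10\<close>, and \<open>(11/9)\<^sup>2 < 3/2\<close>\<close>
  have "scaled_cond2 C \<le> ((1 + t) / (1 - t))\<^sup>2 * K"
    unfolding K_def using t by (intro scaled_cond2_perturbation[OF T_spd C_spd n _ _ CT]) auto
  also have "\<dots> \<le> (11 / 9)\<^sup>2 * K"
    using t K by (intro mult_right_mono power_mono) (auto simp: field_simps)
  also have "\<dots> \<le> 3 / 2 * K" using K by (simp add: power2_eq_square)
  finally have KC: "scaled_cond2 C \<le> 3 / 2 * K" .
  have KC1: "1 \<le> scaled_cond2 C" by (rule eigval_unit_diag_bounds(4)[OF C_spd n])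
  define a where "a = P * u * K"
  have P0: "0 \<le> P" using P by linarith
  have a: "0 \<le> a" using P0 u K by (simp add: a_def)
  define c where "c = poly pJ (real n) * u * scaled_cond2 C"
  have "c \<le> P * u * scaled_cond2 C"
    unfolding c_def using P u KC1 by (intro mult_right_mono) auto
  also have "\<dots> \<le> P * u * (3 / 2 * K)" using P0 u KC by (intro mult_left_mono) auto
  finally have c: "c \<le> 3 / 2 * a" by (simp add: a_def)
  have small': "4 * a + 3 * real n * K * u < 1" using small by (simp add: a_def K_def algebra_simps)
  moreover have "0 \<le> 3 * real n * K * u" using K u by simp
  ultimately have "4 * a < 1" by linarith
  hence "c < 1" using c a by linarith
  hence 3: "\<bar>kth_largest k (jac C) - eigval k C\<bar> \<le> c * eigval k C"
    using jac C_spd k unfolding accurate_jacobi_def c_def by blast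
  have 1: "\<bar>eigval k T - eigval k A\<bar> \<le> h * eigval k A"
    unfolding T using ostrowski(2,3)[OF A Q h(2) near k] by (simp add: abs_le_iff algebra_simps)
  have 2: "\<bar>eigval k C - eigval k T\<bar> \<le> t * eigval k T"
  proof -
    have "eigval k C \<le> (1 + t) * eigval k T"
      using t by (intro eigval_mono_scaled[OF C'(1,2) T' _ k Chi]) auto
    moreover have "eigval k T \<le> 1 / (1 - t) * eigval k C"
      using t by (intro eigval_mono_scaled[OF T' C'(1,2) _ k Clo]) auto
    hence "(1 - t) * eigval k T \<le> eigval k C" using t by (simp add: field_simps)
    ultimately show ?thesis by (simp add: abs_le_iff algebra_simps)
  qed
  have "\<bar>kth_largest k (jac C) - eigval k A\<bar> / eigval k A \<le> 4 * a + 2 * t + h"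
    by (rule relative_error_accumulation[OF spd_eigval_pos[OF A k] h0 h(2) t a 1 2 3 c])
  also have "\<dots> \<le> (4 * P + 3 * real n) * K * u + h"
  proof -
    have "0 \<le> u * real n * K" using u K by simp
    thus ?thesis by (simp add: a_def t_def algebra_simps)
  qed
  finally show ?thesis by (simp add: K_def)
qed

theorem theorem2p2:
  fixes p1 pJ :: "real poly"
  assumes "degree pJ \<le> 2"
  shows "\<exists>p3 :: real poly. degree p3 \<le> 2 \<and>
    (\<forall>(n :: nat) (u :: real) (uh :: real) (m :: real) (jac :: real mat \<Rightarrow> real list)
      (A :: real mat) (Q :: real mat) (Acomp :: real mat).
      0 < uh \<and> uh < u \<and> u < 1 / 10 \<and> real n * uh < real n * u \<and> real n * u < 1 / 2 \<longrightarrow>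
      0 < m \<and> accurate_jacobi pJ u (m * u) jac \<longrightarrow>
      spd n A \<longrightarrow>
      Q \<in> carrier_mat n n \<longrightarrow>
      mat_norm2 (transpose_mat Q * Q - 1\<^sub>m n) \<le> poly p1 (real n) * u \<longrightarrow>
      poly p1 (real n) * u < 1 \<longrightarrow>
      computed_precond u uh A Q Acomp \<longrightarrow>
      (let \<gamma>h = real n * uh / (1 - real n * uh);
           p1u = poly p1 (real n) * u;
           Atil = transpose_mat Q * A * Q
       in
         10 * real n powr (3 / 2) * u * inverse (1 - p1u) * cond2 A < 1 \<longrightarrow>
         \<gamma>h < u * (1 - p1u) / (16 * sqrt (real n) * cond2 A) \<longrightarrow>
         14 * real n * u * scaled_cond2 Atil < 1 \<longrightarrow>
         poly p3 (real n) * scaled_cond2 Atil * u < 1 \<longrightarrow>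
         (\<forall>k \<in> {1..n}.
            \<bar>kth_largest k (jac Acomp) - eigval k A\<bar> / eigval k A
              \<le> poly p3 (real n) * scaled_cond2 Atil * u + p1u)))"
proof -
  define p3 where "p3 = Polynomial.smult 4 (map_poly abs pJ) + [:0, 3:]"
  have "degree p3 \<le> 2"
    unfolding p3_def using assms degree_map_poly_le[of abs pJ]
    by (intro degree_add_le order_trans[OF degree_smult_le]) auto
  moreover have p3: "poly p3 (real n) = 4 * poly (map_poly abs pJ) (real n) + 3 * real n" for n
    by (simp add: p3_def)
  show ?thesis
    unfolding Let_def
  proof (intro exI[of _ p3] conjI allI impI ballI \<open>degree p3 \<le> 2\<close>; elim conjE)
    fix n u uh m jac A Q C k
    assume hyps: "0 < uh" "uh < u" "u < 1 / 10" "real n * uh < real n * u" "real n * u < 1 / 2"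
      "accurate_jacobi pJ u (m * u) jac" "spd n A" "Q \<in> carrier_mat n n"
      "mat_norm2 (transpose_mat Q * Q - 1\<^sub>m n) \<le> poly p1 (real n) * u"
      "poly p1 (real n) * u < 1" "computed_precond u uh A Q C"
      "real n * uh / (1 - real n * uh)
        < u * (1 - poly p1 (real n) * u) / (16 * sqrt (real n) * cond2 A)"
      "14 * real n * u * scaled_cond2 (transpose_mat Q * A * Q) < 1"
      "poly p3 (real n) * scaled_cond2 (transpose_mat Q * A * Q) * u < 1" "k \<in> {1..n}"
    have "real n * uh < 1" using hyps(4,5) by linarith
    thus "\<bar>kth_largest k (jac C) - eigval k A\<bar> / eigval k A
        \<le> poly p3 (real n) * scaled_cond2 (transpose_mat Q * A * Q) * u + poly p1 (real n) * u"
      unfolding p3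
      by (intro preconditioned_forward_error[OF hyps(1-3) _ hyps(6-12) refl hyps(13)
            abs_poly_le[OF of_nat_0_le_iff] hyps(14)[unfolded p3] hyps(15)])
  qed
qed

end
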